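(* Let $H$ be a bull or a hammer, and let $G$ be a connected $(C_4, \text{fork}^+, H)$-free graph without clique cutsets or universal cliques. Then $G\in\mathfrak{F}'$ (up to isomorphism) if $H$ is a hammer, and $G$ is a nonempty clique blowup of a graph in $\mathfrak{F}'$ if $H$ is a bull.
   Context: All graphs are finite and simple. $C_k$ is the cycle on $k$ vertices and $P_k$ the path on $k$ vertices. A graph is $(H_1,H_2,\dots)$-free if it has no induced subgraph isomorphic to any $H_i$. A bull is a triangle with two disjoint pendant edges (attached at two different vertices of the triangle). A hammer is obtained by identifying an end of $P_3$ with a vertex of a triangle. A fork$^+$ is obtained from $K_{1,3}$ by subdividing one edge twice (6 vertices). A clique cutset of $G$ is a clique $K$ such that $G-K$ has more components than $G$. A universal clique of $G$ is a nonempty clique $K$ such that every vertex of $K$ is adjacent to every vertex of $V(G)\setminus K$ (in particular, a complete graph has a universal clique). A clique blowup of a graph $F$ with $V(F)=\{v_1,\dots,v_n\}$ is a graph $G$ whose vertex set can be partitioned into $n$ cliques $A_1,\dots,A_n$ (possibly empty) such that, for $i\neq j$, all edges between $A_i$ and $A_j$ are present if $v_iv_j\in E(F)$, and none are present if $v_iv_j\notin E(F)$. It is a nonempty clique blowup if $A_i\neq\emptyset$ for all $i$. Let $v_1v_2v_3v_4v_5v_1$ be a 5-cycle. Define: $F_2'$ is this 5-cycle plus vertices $a_1,a_3$ with added edges $a_1v_1,a_3v_3,a_1a_3$; $F_3$ is the 5-cycle plus $a_1,a_3,a_4$ with added edges $a_iv_i$ $(i=1,3,4)$, $a_1a_3$,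 $a_1a_4$; $F_4$ is the 5-cycle plus $a_1,a_3,a_4,a_5$ with added edges $a_iv_i$ $(i=1,3,4,5)$, $a_1a_3$, $a_1a_4$, $a_3a_5$; $F_5$ is the Petersen graph. Let $\mathfrak{F}'=\{F_2',F_3,F_4,F_5\}\cup\{C_k : k\ge 5 \text{ an integer}\}$. *)

theory Defs
  imports Main
begin

section \<open>Finite simple graphs\<close>

record 'a ugraph =
  verts :: "'a set"
  edges :: "'a set set"

definition simple_graph :: "'a ugraph \<Rightarrow> bool" where
  "simple_graph G \<longleftrightarrow>
     finite (verts G) \<and> (\<forall>e \<in> edges G. e \<subseteq> verts G \<and> card e = 2)"

definition adjacent :: "'a ugraph \<Rightarrow> 'a \<Rightarrow> 'a \<Rightarrow> bool" where
  "adjacent G u v \<longleftrightarrow> {u, v} \<in> edges G"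

definition induced :: "'a ugraph \<Rightarrow> 'a set \<Rightarrow> 'a ugraph" where
  "induced G S = \<lparr>verts = verts G \<inter> S, edges = {e \<in> edges G. e \<subseteq> S}\<rparr>"

definition delete_verts :: "'a ugraph \<Rightarrow> 'a set \<Rightarrow> 'a ugraph" where
  "delete_verts G S = induced G (verts G - S)"

definition graph_iso :: "'a ugraph \<Rightarrow> 'b ugraph \<Rightarrow> bool"  (infix "\<cong>\<^sub>g" 50) where
  "G \<cong>\<^sub>g H \<longleftrightarrow>
     (\<exists>f. bij_betw f (verts G) (verts H) \<and>
          (\<forall>u \<in> verts G. \<forall>v \<in> verts G. adjacent G u v \<longleftrightarrow> adjacent H (f u) (f v)))"

definition induced_free :: "'a ugraph \<Rightarrow> 'b ugraph \<Rightarrow> bool" where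
  "induced_free G H \<longleftrightarrow> \<not> (\<exists>S \<subseteq> verts G. induced G S \<cong>\<^sub>g H)"

definition reach_rel :: "'a ugraph \<Rightarrow> ('a \<times> 'a) set" where
  "reach_rel G = {(u, v). adjacent G u v}\<^sup>* \<inter> (verts G \<times> verts G)"

definition components :: "'a ugraph \<Rightarrow> 'a set set" where
  "components G = verts G // reach_rel G"

text \<open>The graph without vertices is not regarded as connected.\<close>

definition connected_graph :: "'a ugraph \<Rightarrow> bool" where
  "connected_graph G \<longleftrightarrow>
     verts G \<noteq> {} \<and> (\<forall>u \<in> verts G. \<forall>v \<in> verts G. (u, v) \<in> reach_rel G)"

definition clique :: "'a ugraph \<Rightarrow> 'a set \<Rightarrow> bool" where
  "clique G K \<longleftrightarrow>
     K \<subseteq> verts G \<and> (\<forall>u \<in> K. \<forall>v \<in> K. u \<noteq> v \<longrightarrow> adjacent G u v)"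

definition clique_cutset :: "'a ugraph \<Rightarrow> 'a set \<Rightarrow> bool" where
  "clique_cutset G K \<longleftrightarrow>
     clique G K \<and> card (components (delete_verts G K)) > card (components G)"

definition universal_clique :: "'a ugraph \<Rightarrow> 'a set \<Rightarrow> bool" where
  "universal_clique G K \<longleftrightarrow>
     K \<noteq> {} \<and> clique G K \<and> (\<forall>u \<in> K. \<forall>v \<in> verts G - K. adjacent G u v)"

definition clique_blowup_via :: "'a ugraph \<Rightarrow> 'b ugraph \<Rightarrow> ('b \<Rightarrow> 'a set) \<Rightarrow> bool" where
  "clique_blowup_via G F A \<longleftrightarrow>
     verts G = (\<Union>i \<in> verts F. A i) \<and>
     (\<forall>i \<in> verts F. clique G (A i)) \<and>
     (\<forall>i \<in> verts F. \<forall>j \<in> verts F. i \<noteq> j \<longrightarrow>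
        A i \<inter> A j = {} \<and>
        (if adjacent F i j
         then \<forall>x \<in> A i. \<forall>y \<in> A j. adjacent G x y
         else \<forall>x \<in> A i. \<forall>y \<in> A j. \<not> adjacent G x y))"

definition nonempty_clique_blowup :: "'a ugraph \<Rightarrow> 'b ugraph \<Rightarrow> bool" where
  "nonempty_clique_blowup G F \<longleftrightarrow>
     (\<exists>A. clique_blowup_via G F A \<and> (\<forall>i \<in> verts F. A i \<noteq> {}))"

section \<open>Particular graphs\<close>

text \<open>Only meaningful for \<open>k \<ge> 3\<close>.\<close>

definition cycle_graph :: "nat \<Rightarrow> nat ugraph" where
  "cycle_graph k =
     \<lparr>verts = {1..k}, edges = insert {k, 1} {{i, i + 1} | i. 1 \<le> i \<and> i < k}\<rparr>"

text \<open>Triangle \<open>1 2 3\<close> with pendant edges at \<open>1\<close> and \<open>2\<close>.\<close>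

definition bull_graph :: "nat ugraph" where
  "bull_graph =
     \<lparr>verts = {1, 2, 3, 4, 5},
      edges = {{1, 2}, {2, 3}, {1, 3}, {1, 4}, {2, 5}}\<rparr>"

text \<open>Triangle \<open>1 2 3\<close> and path \<open>3 4 5\<close>.\<close>

definition hammer_graph :: "nat ugraph" where
  "hammer_graph =
     \<lparr>verts = {1, 2, 3, 4, 5},
      edges = {{1, 2}, {2, 3}, {1, 3}, {3, 4}, {4, 5}}\<rparr>"

text \<open>Centre \<open>1\<close>; the twice subdivided edge of the claw is the path \<open>1 4 5 6\<close>.\<close>

definition fork_plus_graph :: "nat ugraph" where
  "fork_plus_graph =
     \<lparr>verts = {1, 2, 3, 4, 5, 6},
      edges = {{1, 2}, {1, 3}, {1, 4}, {4, 5}, {5, 6}}\<rparr>"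

definition extend_graph :: "'a ugraph \<Rightarrow> 'a set \<Rightarrow> 'a set set \<Rightarrow> 'a ugraph" where
  "extend_graph G W E = \<lparr>verts = verts G \<union> W, edges = edges G \<union> E\<rparr>"

text \<open>
  In the following four graphs the vertex \<open>v\<^sub>i\<close> of the 5-cycle is the number \<open>i\<close>,
  and \<open>a\<^sub>i\<close> is the number \<open>5 + i\<close>.
\<close>

definition F2' :: "nat ugraph" where
  "F2' = extend_graph (cycle_graph 5) {6, 8}
           {{6, 1}, {8, 3}, {6, 8}}"

definition F3 :: "nat ugraph" where
  "F3 = extend_graph (cycle_graph 5) {6, 8, 9}
          {{6, 1}, {8, 3}, {9, 4}, {6, 8}, {6, 9}}"

definition F4 :: "nat ugraph" where
  "F4 = extend_graph (cycle_graph 5) {6, 8, 9, 10}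
          {{6, 1}, {8, 3}, {9, 4}, {10, 5}, {6, 8}, {6, 9}, {8, 10}}"

text \<open>The Petersen graph: outer pentagon \<open>v\<^sub>i\<close>, inner pentagram \<open>a\<^sub>i\<close>, and the spokes.\<close>

definition F5 :: "nat ugraph" where
  "F5 = extend_graph (cycle_graph 5) {6, 7, 8, 9, 10}
          {{6, 1}, {7, 2}, {8, 3}, {9, 4}, {10, 5},
           {6, 8}, {8, 10}, {10, 7}, {7, 9}, {9, 6}}"

definition family_F' :: "nat ugraph set" where
  "family_F' = {F2', F3, F4, F5} \<union> {cycle_graph k | k. k \<ge> 5}"

end

theory Submission
  imports Defs
begin

text \<open>
  The graph \<open>G\<close> is read off from one of its holes. By Dirac's argument a graph without clique
  cutsets that is not complete has a hole: a separator of least size is not a clique, and two of its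
  nonadjacent vertices are joined by induced paths on both sides (\<open>hole_exists\<close>). Since \<open>G\<close> is
  \<open>C\<^sub>4\<close>-free, its holes have length at least 5; a 5-hole is taken if there is one.

  Let \<open>v\<close> be the chosen hole of length \<open>k\<close>. A vertex with a neighbour on it is a hub (complete to
  the hole), a copy of some \<open>v i\<close> (with the same neighbours on the rest of the hole), or, only if
  \<open>k = 5\<close>, a pendant (with a single neighbour on the hole); see \<open>hole_neighbour_trichotomy\<close>. All
  other vertices are remote. Let \<open>B i\<close> be the copies of \<open>v i\<close>, including \<open>v i\<close>, and \<open>A i\<close> the
  pendants at \<open>v i\<close>. The forbidden subgraphs determine the edges between these classes: the sets
  \<open>B i\<close> are cliques arranged as the hole is; the sets \<open>A i\<close> are cliques, \<open>A i\<close> is complete to \<open>B i\<close>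
  and anticomplete to the other copies, and two sets \<open>A i\<close>, \<open>A j\<close> with \<open>i \<noteq> j\<close> are complete to each
  other exactly if \<open>v i\<close> and \<open>v j\<close> are not adjacent, and anticomplete otherwise. The hubs form a
  clique that is complete to all copies and pendants.

  The two remaining hypotheses now bite. Pendants at a place \<open>i\<close> without pendants at \<open>i \<plusminus> 2\<close>, and
  remote vertices, would be cut off by a clique of copies and hubs, so there are none of either
  (\<open>no_isolated_pendants_no_remote\<close>); then a hub would be universal, so there are none
  (\<open>no_hubs\<close>). What is left is a blowup of \<open>C\<^sub>k\<close>, or, for \<open>k = 5\<close>, a blowup of an induced
  subgraph of the Petersen graph, where the inner vertices that occur form a subset of the pentagram
  without isolated points. Up to rotation these subsets give \<open>C\<^sub>5\<close>, \<open>F2'\<close>, \<open>F3\<close>, \<open>F4\<close> and \<open>F5\<close>.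
  Two vertices in one bag span a hammer together with a path along the hole, so a hammer-free \<open>G\<close> is
  itself one of these graphs.
\<close>

section \<open>Induced subgraphs and clique separations\<close>

lemma graph_iso_trans:
  assumes "G \<cong>\<^sub>g H" and "H \<cong>\<^sub>g K"
  shows "G \<cong>\<^sub>g K"
proof -
  obtain f where f: "bij_betw f (verts G) (verts H)"
    "\<forall>u \<in> verts G. \<forall>v \<in> verts G. adjacent G u v \<longleftrightarrow> adjacent H (f u) (f v)"
    using assms(1) unfolding graph_iso_def by blast
  obtain g where g: "bij_betw g (verts H) (verts K)"
    "\<forall>u \<in> verts H. \<forall>v \<in> verts H. adjacent H u v \<longleftrightarrow> adjacent K (g u) (g v)"
    using assms(2) unfolding graph_iso_def by blast
  have "f u \<in> verts H" if "u \<in> verts G" for u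
    using f(1) that by (auto simp: bij_betw_def)
  then have "\<forall>u \<in> verts G. \<forall>v \<in> verts G. adjacent G u v \<longleftrightarrow> adjacent K ((g \<circ> f) u) ((g \<circ> f) v)"
    using f(2) g(2) by simp
  then show ?thesis
    unfolding graph_iso_def using bij_betw_trans[OF f(1) g(1)] by blast
qed

lemma graph_iso_sym:
  assumes "G \<cong>\<^sub>g H"
  shows "H \<cong>\<^sub>g G"
proof -
  obtain f where f: "bij_betw f (verts G) (verts H)"
    "\<forall>u \<in> verts G. \<forall>v \<in> verts G. adjacent G u v \<longleftrightarrow> adjacent H (f u) (f v)"
    using assms unfolding graph_iso_def by blast
  let ?g = "inv_into (verts G) f"
  have "bij_betw ?g (verts H) (verts G)"
    by (rule bij_betw_inv_into[OF f(1)])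
  moreover have "?g u \<in> verts G" "f (?g u) = u" if "u \<in> verts H" for u
    using f(1) that by (auto simp: bij_betw_def inv_into_into f_inv_into_f)
  ultimately show ?thesis
    unfolding graph_iso_def using f(2) by (intro exI[of _ ?g]) auto
qed

lemma induced_free_iso:
  "induced_free G H \<Longrightarrow> H \<cong>\<^sub>g H' \<Longrightarrow> induced_free G H'"
  unfolding induced_free_def using graph_iso_trans graph_iso_sym by blast

lemma not_induced_free_if_embedding:
  assumes inj: "inj_on f (verts F)" and sub: "f ` verts F \<subseteq> verts G"
    and adj: "\<And>u v. u \<in> verts F \<Longrightarrow> v \<in> verts F \<Longrightarrow> adjacent G (f u) (f v) \<longleftrightarrow> adjacent F u v"
  shows "\<not> induced_free G F"
proof -
  let ?S = "f ` verts F"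
  have "F \<cong>\<^sub>g induced G ?S"
    unfolding graph_iso_def
  proof (intro exI[of _ f] conjI ballI)
    show "bij_betw f (verts F) (verts (induced G ?S))"
      using inj sub by (auto simp: bij_betw_def induced_def)
  next
    fix u v assume "u \<in> verts F" "v \<in> verts F"
    then show "adjacent F u v \<longleftrightarrow> adjacent (induced G ?S) (f u) (f v)"
      using adj[of u v] by (auto simp: adjacent_def induced_def)
  qed
  then show ?thesis
    unfolding induced_free_def using graph_iso_sym sub by blast
qed

text \<open>
  For a subgraph given by a list of its vertices, the conditions of an embedding are statements
  about list positions, which the simplifier can decide.
\<close>

lemma not_induced_free_if_list:
  assumes "verts F = Suc ` {..<length xs}" and "distinct xs" and "set xs \<subseteq> verts G"
    and "\<forall>i<length xs. \<forall>j<length xs.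
           adjacent G (xs ! i) (xs ! j) \<longleftrightarrow> adjacent F (Suc i) (Suc j)"
  shows "\<not> induced_free G F"
proof (rule not_induced_free_if_embedding[where f = "\<lambda>i. xs ! (i - 1)"])
  show "inj_on (\<lambda>i. xs ! (i - 1)) (verts F)"
    using assms(1,2) by (auto simp: inj_on_def nth_eq_iff_index_eq)
  show "(\<lambda>i. xs ! (i - 1)) ` verts F \<subseteq> verts G"
    using assms(1,3) by auto
qed (use assms(1,4) in auto)

lemma verts_cycle_graph: "verts (cycle_graph k) = {1..k}"
  by (simp add: cycle_graph_def)

lemma adjacent_cycle_graph_iff:
  "adjacent (cycle_graph k) i j \<longleftrightarrow> i = k \<and> j = 1 \<or> i = 1 \<and> j = k \<or>
     1 \<le> i \<and> i < k \<and> j = i + 1 \<or> 1 \<le> j \<and> j < k \<and> i = j + 1"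
  by (auto simp: adjacent_def cycle_graph_def doubleton_eq_iff)

lemma adjacent_cycle_graph:
  assumes "i \<in> {1..k}" and "j \<in> {1..k}"
  shows "adjacent (cycle_graph k) i j \<longleftrightarrow>
    j = i + 1 \<or> i = j + 1 \<or> i = 1 \<and> j = k \<or> i = k \<and> j = 1"
  using assms by (auto simp: adjacent_cycle_graph_iff)

locale simple =
  fixes G :: "'a ugraph"
  assumes simple: "simple_graph G"
begin

abbreviation V :: "'a set" where "V \<equiv> verts G"

abbreviation adj :: "'a \<Rightarrow> 'a \<Rightarrow> bool"  (infix "\<sim>" 50) where
  "u \<sim> v \<equiv> adjacent G u v"

lemma finite_V: "finite V"
  using simple by (simp add: simple_graph_def)

lemma adj_commute: "u \<sim> v \<longleftrightarrow> v \<sim> u"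
  by (simp add: adjacent_def insert_commute)

lemma adj_irrefl [simp]: "\<not> u \<sim> u"
  using simple by (force simp: simple_graph_def adjacent_def)

lemma adj_verts: "u \<sim> v \<Longrightarrow> u \<in> V \<and> v \<in> V"
  using simple by (auto simp: simple_graph_def adjacent_def)

text \<open>
  In an induced copy of a forbidden graph, vertices with different neighbourhoods are distinct for
  free. Only the nonadjacent twins, opposite vertices of \<open>C\<^sub>4\<close> and the two leaves at the centre of
  \<open>fork\<^sup>+\<close>, have to be distinct by assumption.
\<close>

lemma C4_chord:
  assumes "induced_free G (cycle_graph 4)"
    and E: "a \<sim> b" "b \<sim> c" "c \<sim> d" "d \<sim> a" and "a \<noteq> c" "b \<noteq> d"
  shows "a \<sim> c \<or> b \<sim> d"
proof (rule ccontr)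
  assume N: "\<not> (a \<sim> c \<or> b \<sim> d)"
  have "distinct [a, b, c, d]"
    using E assms(6,7) by auto
  moreover have "set [a, b, c, d] \<subseteq> V"
    using E adj_verts by auto
  ultimately have "\<not> induced_free G (cycle_graph 4)"
    using E N E[THEN adj_commute[THEN iffD1]]
    by (intro not_induced_free_if_list[of _ "[a, b, c, d]"])
       (simp_all add: verts_cycle_graph adjacent_cycle_graph image_Suc_lessThan All_less_Suc
         adj_commute[of c a] adj_commute[of d b])
  then show False using assms(1) by contradiction
qed

lemma bull_chord:
  assumes "induced_free G bull_graph"
    and E: "a \<sim> b" "b \<sim> c" "a \<sim> c" "a \<sim> d" "b \<sim> e"
  shows "d \<sim> b \<or> d \<sim> c \<or> e \<sim> a \<or> e \<sim> c \<or> d \<sim> e"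
proof (rule ccontr)
  assume N: "\<not> (d \<sim> b \<or> d \<sim> c \<or> e \<sim> a \<or> e \<sim> c \<or> d \<sim> e)"
  have "distinct [a, b, c, d, e]"
    using E N by (auto simp: adj_commute)
  moreover have "set [a, b, c, d, e] \<subseteq> V"
    using E adj_verts by auto
  ultimately have "\<not> induced_free G bull_graph"
    using E N E[THEN adj_commute[THEN iffD1]]
    by (intro not_induced_free_if_list[of _ "[a, b, c, d, e]"])
       (simp_all add: numeral_eq_Suc All_less_Suc lessThan_Suc insert_commute bull_graph_def
         adjacent_def[of "\<lparr>verts = _, edges = _\<rparr>"] doubleton_eq_iff adj_commute[of d b]
         adj_commute[of d c] adj_commute[of e a] adj_commute[of e c] adj_commute[of e d])
  then show False using assms(1) by contradiction
qed

lemma hammer_chord: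
  assumes "induced_free G hammer_graph"
    and E: "a \<sim> b" "b \<sim> c" "a \<sim> c" "c \<sim> d" "d \<sim> e"
  shows "a \<sim> d \<or> b \<sim> d \<or> a \<sim> e \<or> b \<sim> e \<or> c \<sim> e"
proof (rule ccontr)
  assume N: "\<not> (a \<sim> d \<or> b \<sim> d \<or> a \<sim> e \<or> b \<sim> e \<or> c \<sim> e)"
  have "distinct [a, b, c, d, e]"
    using E N by (auto simp: adj_commute)
  moreover have "set [a, b, c, d, e] \<subseteq> V"
    using E adj_verts by auto
  ultimately have "\<not> induced_free G hammer_graph"
    using E N E[THEN adj_commute[THEN iffD1]]
    by (intro not_induced_free_if_list[of _ "[a, b, c, d, e]"])
       (simp_all add: numeral_eq_Suc All_less_Suc lessThan_Suc insert_commute hammer_graph_def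
         adjacent_def[of "\<lparr>verts = _, edges = _\<rparr>"] doubleton_eq_iff adj_commute[of d a]
         adj_commute[of d b] adj_commute[of e a] adj_commute[of e b] adj_commute[of e c])
  then show False using assms(1) by contradiction
qed

lemma fork_plus_chord:
  assumes "induced_free G fork_plus_graph"
    and E: "c \<sim> a" "c \<sim> b" "c \<sim> p" "p \<sim> q" "q \<sim> r" and "a \<noteq> b"
  shows "a \<sim> b \<or> a \<sim> p \<or> a \<sim> q \<or> a \<sim> r \<or> b \<sim> p \<or> b \<sim> q \<or> b \<sim> r
    \<or> c \<sim> q \<or> c \<sim> r \<or> p \<sim> r"
proof (rule ccontr)
  assume N: "\<not> ?thesis"
  have "distinct [c, a, b, p, q, r]"
    using E N \<open>a \<noteq> b\<close> by (auto simp: adj_commute)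
  moreover have "set [c, a, b, p, q, r] \<subseteq> V"
    using E adj_verts by auto
  ultimately have "\<not> induced_free G fork_plus_graph"
    using E N E[THEN adj_commute[THEN iffD1]]
    by (intro not_induced_free_if_list[of _ "[c, a, b, p, q, r]"])
       (simp_all add: numeral_eq_Suc All_less_Suc lessThan_Suc insert_commute fork_plus_graph_def
         adjacent_def[of "\<lparr>verts = _, edges = _\<rparr>"] doubleton_eq_iff
         adj_commute[of b a] adj_commute[of p a] adj_commute[of q a] adj_commute[of r a] adj_commute[of p b]
         adj_commute[of q b] adj_commute[of r b] adj_commute[of q c] adj_commute[of r c] adj_commute[of r p])
  then show False using assms(1) by contradiction
qed

definition separation :: "'a set \<Rightarrow> 'a set \<Rightarrow> 'a set \<Rightarrow> bool" where
  "separation X S Y \<longleftrightarrow>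
     V = X \<union> S \<union> Y \<and> X \<inter> S = {} \<and> X \<inter> Y = {} \<and> S \<inter> Y = {} \<and> X \<noteq> {} \<and> Y \<noteq> {} \<and>
     (\<forall>x \<in> X. \<forall>y \<in> Y. \<not> x \<sim> y)"

lemma separation_sym: "separation X S Y \<Longrightarrow> separation Y S X"
  unfolding separation_def using adj_commute by blast

text \<open>
  Two vertices on different sides lie in different components after the deletion, while a connected
  graph has just one. The clique may be empty.
\<close>

lemma clique_cutset_if_separation:
  assumes "connected_graph G" and "clique G S" and sep: "separation X S Y"
  shows "clique_cutset G S"
proof -
  have "reach_rel G = V \<times> V"
    using assms(1) by (auto simp: connected_graph_def reach_rel_def)
  then have "components G = {V}"
    using assms(1) by (auto simp: components_def connected_graph_def quotient_def)
  moreover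
  let ?H = "delete_verts G S"
  have verts_H: "verts ?H = X \<union> Y"
    using sep by (auto simp: separation_def delete_verts_def induced_def)
  obtain x y where x: "x \<in> X" and y: "y \<in> Y"
    using sep by (auto simp: separation_def)
  have H_adj: "u \<sim> v \<and> u \<in> X \<union> Y \<and> v \<in> X \<union> Y" if "adjacent ?H u v" for u v
    using that sep by (auto simp: adjacent_def delete_verts_def induced_def separation_def)
  have stays: "v \<in> X" if "(x, v) \<in> {(u, v). adjacent ?H u v}\<^sup>*" for v
    using that
  proof (induction rule: rtrancl_induct)
    case (step u v)
    then show ?case using H_adj[of u v] sep by (auto simp: separation_def)
  qed (rule x)
  have "reach_rel ?H `` {x} \<noteq> reach_rel ?H `` {y}"
  proof
    assume "reach_rel ?H `` {x} = reach_rel ?H `` {y}"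
    moreover have "y \<in> reach_rel ?H `` {y}"
      using y verts_H by (simp add: reach_rel_def)
    ultimately have "y \<in> X"
      using stays by (auto simp: reach_rel_def)
    then show False using y sep by (auto simp: separation_def)
  qed
  moreover have "{reach_rel ?H `` {x}, reach_rel ?H `` {y}} \<subseteq> components ?H"
    using x y verts_H by (auto simp: components_def quotient_def)
  moreover have "finite (components ?H)"
  proof -
    have "finite (verts ?H)"
      using finite_V by (simp add: delete_verts_def induced_def)
    then show ?thesis by (simp add: components_def quotient_def)
  qed
  ultimately have "card (components ?H) \<ge> 2"
    by (metis card_2_iff card_mono)
  with \<open>components G = {V}\<close> assms(2) show ?thesis
    by (simp add: clique_cutset_def)
qed

end

section \<open>Holes\<close>

lemma dvd_diff_mod: "k dvd i - j + d \<longleftrightarrow> k dvd i mod k - j mod k + d" for k :: int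
proof -
  have "(i - j + d) mod k = (i mod k - j mod k + d) mod k"
    by (metis mod_add_left_eq mod_diff_eq)
  then show ?thesis by (simp add: dvd_eq_mod_eq_0)
qed

text \<open>
  A hole is an induced cycle, given by a periodic enumeration of its vertices by the integers. So a
  rotation is a shift of the index, and the neighbours of \<open>v i\<close> are \<open>v (i - 1)\<close> and \<open>v (i + 1)\<close>
  without any reduction modulo \<open>k\<close>.
\<close>

definition (in simple) hole :: "int \<Rightarrow> (int \<Rightarrow> 'a) \<Rightarrow> bool" where
  "hole k v \<longleftrightarrow> range v \<subseteq> V \<and> (\<forall>i j. v i = v j \<longleftrightarrow> k dvd i - j) \<and>
     (\<forall>i j. v i \<sim> v j \<longleftrightarrow> k dvd i - j - 1 \<or> k dvd i - j + 1)"

context simple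
begin

definition induced_path :: "'a set \<Rightarrow> nat \<Rightarrow> (nat \<Rightarrow> 'a) \<Rightarrow> bool" where
  "induced_path X n p \<longleftrightarrow> (\<forall>i. 0 < i \<and> i < n \<longrightarrow> p i \<in> X) \<and>
     (\<forall>i j. i < j \<and> j \<le> n \<longrightarrow> p i \<noteq> p j \<and> (p i \<sim> p j \<longleftrightarrow> j = Suc i))"

text \<open>
  If the part of \<open>X\<close> reachable from \<open>x\<close> through \<open>X\<close> had no edge to \<open>y\<close>, then
  \<open>y\<close> could be moved out of the separator, against its minimality; and if nothing in \<open>X\<close> is
  reachable, \<open>x\<close> itself could be moved. So \<open>x\<close> and \<open>y\<close> are joined through \<open>X\<close>, and a
  shortest walk is an induced path.
\<close>

lemma minimal_separator_path:
  assumes sep: "separation X S Y"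
    and min: "\<forall>X' S' Y'. separation X' S' Y' \<longrightarrow> card S \<le> card S'"
    and x: "x \<in> S" and y: "y \<in> S" and "x \<noteq> y"
  obtains n p where "induced_path X n p" and "p 0 = x" and "p n = y" and "n > 0"
proof -
  define walk where "walk u n p \<longleftrightarrow> p 0 = x \<and> p n = u \<and> n > 0 \<and> (\<forall>i<n. p i \<sim> p (Suc i)) \<and>
    (\<forall>i. 0 < i \<and> i < n \<longrightarrow> p i \<in> X)" for u n and p :: "nat \<Rightarrow> 'a"
  define R where "R = {u \<in> X. \<exists>n p. walk u n p}"
  have S_fin: "finite S"
    using sep finite_V by (auto simp: separation_def intro: finite_subset)
  have smaller: "False" if "separation X' (S - {s}) Y'" "s \<in> S" for X' Y' s
    using min that(1) card_Diff1_less[OF S_fin that(2)] by (meson not_le)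
  have extend: "\<exists>n p. walk w n p" if u: "u \<in> R" and uw: "u \<sim> w" for u w
  proof -
    obtain n p where "u \<in> X" "walk u n p" using u by (auto simp: R_def)
    then have "walk w (Suc n) (p(Suc n := w))"
      using uw by (auto simp: walk_def less_Suc_eq)
    then show ?thesis by blast
  qed
  have "R \<noteq> {}"
  proof
    assume "R = {}"
    have "\<not> x \<sim> u" if "u \<in> X" for u
    proof
      assume "x \<sim> u"
      then have "walk u 1 (\<lambda>i. if i = 0 then x else u)" by (auto simp: walk_def)
      then show False using \<open>R = {}\<close> that unfolding R_def by blast
    qed
    then have "separation X (S - {x}) (insert x Y)"
      using sep x unfolding separation_def using adj_commute by blast
    then show False using smaller x by blast
  qed
  have "\<exists>u \<in> R. u \<sim> y"
  proof (rule ccontr)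
    assume no: "\<not> ?thesis"
    have apart: "\<not> u \<sim> w" if "u \<in> R" "w \<in> insert y (Y \<union> (X - R))" for u w
    proof
      assume "u \<sim> w"
      show False
      proof (cases "w \<in> X")
        case True
        then have "w \<in> R" using extend[OF that(1) \<open>u \<sim> w\<close>] by (simp add: R_def)
        then show ?thesis using that(2) True sep y by (auto simp: separation_def)
      next
        case False
        then have "w \<in> Y" using that no \<open>u \<sim> w\<close> by blast
        moreover have "u \<in> X" using that(1) by (simp add: R_def)
        ultimately show ?thesis using sep \<open>u \<sim> w\<close> unfolding separation_def by blast
      qed
    qed
    have RX: "R \<subseteq> X" by (auto simp: R_def)
    have "separation R (S - {y}) (insert y (Y \<union> (X - R)))"
      unfolding separation_def
    proof (intro conjI)
      have "V = X \<union> S \<union> Y" using sep by (simp add: separation_def)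
      then show "V = R \<union> (S - {y}) \<union> insert y (Y \<union> (X - R))" using RX y by auto
      have "X \<inter> S = {}" "X \<inter> Y = {}" "S \<inter> Y = {}" using sep by (simp_all add: separation_def)
      then show "R \<inter> (S - {y}) = {}" "R \<inter> insert y (Y \<union> (X - R)) = {}"
        "(S - {y}) \<inter> insert y (Y \<union> (X - R)) = {}" using RX y by auto
    qed (use apart \<open>R \<noteq> {}\<close> in auto)
    then show False using smaller y by blast
  qed
  then have "\<exists>n p. walk y n p" using extend by blast
  define n where "n = (LEAST n. \<exists>p. walk y n p)"
  obtain p where w: "walk y n p"
    unfolding n_def using \<open>\<exists>n p. walk y n p\<close> LeastI_ex[of "\<lambda>n. \<exists>p. walk y n p"] by blast
  have least: "n \<le> m" if "walk y m q" for m q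
    unfolding n_def using that by (blast intro: Least_le)
  have jump: "j \<le> i + d" if ij: "i < j" "j \<le> n" and d: "d \<le> 1" and
    eq: "d = 0 \<Longrightarrow> p i = p j" and ad: "d = 1 \<Longrightarrow> p i \<sim> p j" for i j d
    \<comment> \<open>At a repeated vertex (\<open>d = 0\<close>) or a chord (\<open>d = 1\<close>) of the walk, the stretch between the
      two positions could be skipped, which would give a shorter walk.\<close>
  proof (rule ccontr)
    assume "\<not> ?thesis"
    then have gap: "i + d < j" by simp
    define q where "q m = (if m \<le> i then p m else p (m + (j - (i + d))))" for m
    have "n - (j - (i + d)) > 0"
    proof (rule ccontr)
      assume "\<not> ?thesis"
      then have "i = 0" "d = 0" "j = n" using ij gap by auto
      then show False using eq w \<open>x \<noteq> y\<close> by (auto simp: walk_def)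
    qed
    moreover have "q (n - (j - (i + d))) = y"
    proof (cases "n - (j - (i + d)) \<le> i")
      case True
      then have "d = 0" "j = n" using ij gap by auto
      then show ?thesis using eq w True ij by (simp add: q_def walk_def)
    next
      case False
      then show ?thesis using w ij gap by (simp add: q_def walk_def)
    qed
    moreover have "q m \<sim> q (Suc m)" if "m < n - (j - (i + d))" for m
    proof -
      consider "m < i" | "m = i" | "m > i" by linarith
      then show ?thesis
      proof cases
        case 1
        then show ?thesis using w ij by (simp add: q_def walk_def)
      next
        case 2
        have "p i \<sim> p (Suc i + (j - (i + d)))"
        proof (cases "d = 0")
          case True
          then have "p j \<sim> p (Suc j)" using w 2 that ij by (simp add: walk_def)
          then show ?thesis using True eq ij by simp
        next
          case False
          then show ?thesis using d ad gap by (simp add: le_Suc_eq)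
        qed
        then show ?thesis using 2 by (simp add: q_def)
      next
        case 3
        then show ?thesis using w that by (simp add: q_def walk_def)
      qed
    qed
    moreover have "q m \<in> X" if "0 < m" "m < n - (j - (i + d))" for m
      using w that ij by (auto simp: q_def walk_def)
    ultimately have "walk y (n - (j - (i + d))) q"
      using w by (auto simp: walk_def q_def)
    from least[OF this] gap ij show False by linarith
  qed
  have "p i \<noteq> p j \<and> (p i \<sim> p j \<longleftrightarrow> j = Suc i)" if "i < j" "j \<le> n" for i j
    using jump[of i j 0] jump[of i j 1] that w by (auto simp: walk_def)
  then have "induced_path X n p"
    using w by (simp add: induced_path_def walk_def)
  then show thesis using that w by (simp add: walk_def)
qed

text \<open>
  The cycle runs along \<open>p\<close> and back along \<open>q\<close>. A chord would join the two interiors, which lie on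
  different sides of the separation, or be a chord of one of the paths.
\<close>

lemma hole_from_paths:
  assumes sep: "separation X S Y" and p: "induced_path X n p" and q: "induced_path Y m q"
    and ends: "p 0 = q 0" "p n = q m" and non: "\<not> p 0 \<sim> p n" "p 0 \<noteq> p n"
    and "p 0 \<in> S" "p n \<in> S"
  obtains k v where "k \<ge> 4" and "hole k v"
proof -
  have "n \<noteq> 0" "m \<noteq> 0" using non ends by metis+
  moreover have "n \<noteq> 1"
  proof
    assume "n = 1"
    then have "p 0 \<sim> p n"
      using p[unfolded induced_path_def, THEN conjunct2, rule_format, of 0 1] by simp
    then show False using non by blast
  qed
  moreover have "m \<noteq> 1"
  proof
    assume "m = 1"
    then have "q 0 \<sim> q m"
      using q[unfolded induced_path_def, THEN conjunct2, rule_format, of 0 1] by simp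
    then show False using non ends by simp
  qed
  ultimately have nm: "n \<ge> 2" "m \<ge> 2" by auto
  define c where "c i = (if i \<le> n then p i else q (n + m - i))" for i
  have c_p: "c i = p i" if "i \<le> n" for i using that by (simp add: c_def)
  have c_q: "c i = q (n + m - i)" if "i \<ge> n" for i using that ends by (simp add: c_def)
  have X_in: "c i \<in> X" if "0 < i" "i < n" for i
    using p that by (simp add: c_p induced_path_def)
  have Y_in: "c i \<in> Y" if "n < i" "i < n + m" for i
    using q that by (simp add: c_q induced_path_def)
  have c: "c i \<noteq> c j \<and> (c i \<sim> c j \<longleftrightarrow> j = Suc i \<or> i = 0 \<and> Suc j = n + m)"
    if ij: "i < j" "j < n + m" for i j
  proof -
    consider (p) "j \<le> n" | (q) "n \<le> i" | (0) "i = 0" "n < j" | (x) "0 < i" "i < n" "n < j"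
      using ij by linarith
    then show ?thesis
    proof cases
      case p
      then show ?thesis using assms(2) ij nm by (auto simp: c_p induced_path_def)
    next
      case q
      have "q (n + m - j) \<noteq> q (n + m - i) \<and>
        (q (n + m - j) \<sim> q (n + m - i) \<longleftrightarrow> n + m - i = Suc (n + m - j))"
        using assms(3)[unfolded induced_path_def, THEN conjunct2, rule_format, of "n + m - j" "n + m - i"]
          ij q by (auto simp: diff_less_mono2)
      then show ?thesis
        using ij q nm adj_commute[of "c i" "c j"] by (auto simp: c_q)
    next
      case 0
      have "q 0 \<noteq> q (n + m - j) \<and> (q 0 \<sim> q (n + m - j) \<longleftrightarrow> n + m - j = Suc 0)"
        using assms(3)[unfolded induced_path_def, THEN conjunct2, rule_format, of 0 "n + m - j"]
          ij 0 by auto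
      then show ?thesis
        using 0 nm ij ends by (auto simp: c_p c_q)
    next
      case x
      then have "c i \<in> X" "c j \<in> Y" using X_in Y_in ij by auto
      then show ?thesis using sep x by (auto simp: separation_def)
    qed
  qed
  have c_V: "c i \<in> V" if "i < n + m" for i
  proof -
    consider "i = 0" | "0 < i" "i < n" | "i = n" | "n < i" by linarith
    then show ?thesis
      using X_in[of i] Y_in[of i] sep that assms(8,9) c_p[of i] by cases (auto simp: separation_def)
  qed
  define k where "k = int (n + m)"
  define v where "v i = c (nat (i mod k))" for i
  have k: "k > 0" "k \<ge> 4" using nm by (auto simp: k_def)
  have lt: "nat (i mod k) < n + m" for i
    using pos_mod_bound[OF k(1), of i] pos_mod_sign[OF k(1), of i] by (simp add: k_def)
  have small: "k dvd d \<longleftrightarrow> d = 0 \<or> d = k \<or> d = - k" if "- k \<le> d" "d \<le> k" for d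
  proof
    assume "k dvd d"
    then obtain t where t: "d = k * t" by blast
    then have "k * t \<le> k * 1" "k * (- 1) \<le> k * t" using that by auto
    then have "t \<le> 1" "- 1 \<le> t" using k(1) by (simp_all only: mult_le_cancel_left_pos)
    then have "t = 0 \<or> t = 1 \<or> t = - 1" by auto
    then show "d = 0 \<or> d = k \<or> d = - k" using t by auto
  qed auto
  have "hole k v"
    unfolding hole_def
  proof (intro conjI allI)
    show "range v \<subseteq> V" using c_V lt by (auto simp: v_def)
  next
    fix i j
    define a b where "a = nat (i mod k)" and "b = nat (j mod k)"
    have ab: "i mod k = int a" "j mod k = int b" "int a < k" "int b < k" "a < n + m" "b < n + m"
      using k(1) lt by (simp_all add: a_def b_def)
    have v: "v i = c a" "v j = c b"
      by (simp_all add: v_def a_def b_def)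
    have E: "v i = v j \<longleftrightarrow> a = b"
      using c[of a b] c[of b a] ab(5,6) v by (cases a b rule: linorder_cases) auto
    show "v i = v j \<longleftrightarrow> k dvd i - j"
      using dvd_diff_mod[of k i j 0] small[of "int a - int b"] ab k(1) unfolding E by auto
    have A: "v i \<sim> v j \<longleftrightarrow> b = Suc a \<or> a = Suc b \<or> a = 0 \<and> Suc b = n + m \<or> b = 0 \<and> Suc a = n + m"
      using c[of a b] c[of b a] ab(5,6) adj_commute[of "c a" "c b"] nm unfolding v
      by (cases a b rule: linorder_cases) auto
    have "k dvd i - j + 1 \<longleftrightarrow> int a - int b + 1 = 0 \<or> int a - int b + 1 = k"
      using dvd_diff_mod[of k i j 1] small[of "int a - int b + 1"] ab k(1) by simp
    moreover have "k dvd i - j - 1 \<longleftrightarrow> int a - int b - 1 = 0 \<or> int a - int b - 1 = - k"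
      using dvd_diff_mod[of k i j "- 1"] small[of "int a - int b - 1"] ab k(1) by simp
    ultimately show "v i \<sim> v j \<longleftrightarrow> k dvd i - j - 1 \<or> k dvd i - j + 1"
      unfolding A using ab(3-6) k_def by linarith
  qed
  then show thesis using that k by blast
qed

text \<open>
  Dirac: a separator of least size is not a clique, and any two of its nonadjacent vertices lie
  on a hole with an arc on either side.
\<close>

lemma hole_exists:
  assumes "connected_graph G" and "\<not> (\<exists>K. clique_cutset G K)"
    and "x \<in> V" "y \<in> V" "x \<noteq> y" "\<not> x \<sim> y"
  obtains k v where "k \<ge> 4" and "hole k v"
proof -
  have "\<exists>X S Y. separation X S Y"
    using assms(3-6) by (intro exI[of _ "{x}"] exI[of _ "V - {x, y}"] exI[of _ "{y}"])
      (auto simp: separation_def)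
  then have "\<exists>s. (\<exists>X Y. separation X s Y) \<and> (\<forall>s'. (\<exists>X Y. separation X s' Y) \<longrightarrow> card s \<le> card s')"
    using ex_has_least_nat[of "\<lambda>s. \<exists>X Y. separation X s Y" _ card] by blast
  then obtain X S Y where sep: "separation X S Y"
    and min: "\<forall>X' S' Y'. separation X' S' Y' \<longrightarrow> card S \<le> card S'" by blast
  have "\<not> clique G S"
    using clique_cutset_if_separation[OF assms(1) _ sep] assms(2) by blast
  moreover have "S \<subseteq> V" using sep by (auto simp: separation_def)
  ultimately obtain a b where ab: "a \<in> S" "b \<in> S" "a \<noteq> b" "\<not> a \<sim> b"
    by (auto simp: clique_def)
  obtain n p where p: "induced_path X n p" "p 0 = a" "p n = b" "n > 0"
    by (rule minimal_separator_path[OF sep min ab(1-3)])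
  obtain m q where q: "induced_path Y m q" "q 0 = a" "q m = b" "m > 0"
    by (rule minimal_separator_path[OF separation_sym[OF sep] min ab(1-3)])
  have ends: "p 0 = q 0" "p n = q m" "\<not> p 0 \<sim> p n" "p 0 \<noteq> p n" "p 0 \<in> S" "p n \<in> S"
    using p q ab by simp_all
  show thesis
    by (rule hole_from_paths[OF sep p(1) q(1) ends]) (rule that)
qed

end

section \<open>Neighbours of a hole\<close>

lemma (in simple) hole_5I:
  assumes E: "a \<sim> b" "b \<sim> c" "c \<sim> d" "d \<sim> e" "e \<sim> a"
    and N: "\<not> a \<sim> c" "\<not> a \<sim> d" "\<not> b \<sim> d" "\<not> b \<sim> e" "\<not> c \<sim> e"
  shows "\<exists>w. hole 5 w"
proof -
  define w where "w i = (let r = i mod 5 in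
    if r = 0 then a else if r = 1 then b else if r = 2 then c else if r = 3 then d else e)" for i :: int
  have neq: "a \<noteq> b" "a \<noteq> c" "a \<noteq> d" "a \<noteq> e" "b \<noteq> c" "b \<noteq> d" "b \<noteq> e" "c \<noteq> d" "c \<noteq> e" "d \<noteq> e"
    using E N adj_commute by (metis adj_irrefl)+
  have V: "a \<in> V" "b \<in> V" "c \<in> V" "d \<in> V" "e \<in> V"
    using E adj_verts by auto
  have "range w \<subseteq> V" using V by (auto simp: w_def Let_def)
  moreover have "(w i = w j \<longleftrightarrow> 5 dvd i - j) \<and>
      (w i \<sim> w j \<longleftrightarrow> 5 dvd i - j - 1 \<or> 5 dvd i - j + 1)" for i j
  proof -
    have m: "n mod 5 = 0 \<or> n mod 5 = 1 \<or> n mod 5 = 2 \<or> n mod 5 = 3 \<or> n mod 5 = 4" for n :: int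
      by presburger
    have r: "5 dvd i - j \<longleftrightarrow> 5 dvd i mod 5 - j mod 5"
      "5 dvd i - j + 1 \<longleftrightarrow> 5 dvd i mod 5 - j mod 5 + 1"
      "5 dvd i - j - 1 \<longleftrightarrow> 5 dvd i mod 5 - j mod 5 - 1"
      using dvd_diff_mod[of 5 i j 0] dvd_diff_mod[of 5 i j 1] dvd_diff_mod[of 5 i j "- 1"] by simp_all
    note E' = E[THEN adj_commute[THEN iffD1]]
    note N' = N[unfolded adj_commute[of a c] adj_commute[of a d] adj_commute[of b d]
      adj_commute[of b e] adj_commute[of c e]]
    show ?thesis
      unfolding r using m[of i] m[of j]
      by (elim disjE) (simp_all add: w_def neq neq[symmetric] E E' N N')
  qed
  ultimately have "hole 5 w" by (simp add: hole_def)
  then show ?thesis by blast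
qed

locale cutset_free = simple +
  assumes conn: "connected_graph G"
    and no_C4: "induced_free G (cycle_graph 4)"
    and no_fork_plus: "induced_free G fork_plus_graph"
    and bull_or_hammer: "induced_free G bull_graph \<or> induced_free G hammer_graph"
    and no_clique_cutset: "\<not> (\<exists>K. clique_cutset G K)"
    and no_universal_clique: "\<not> (\<exists>K. universal_clique G K)"
begin

lemma not_universal:
  assumes "x \<in> V"
  obtains y where "y \<in> V" "y \<noteq> x" "\<not> x \<sim> y"
proof -
  have "\<not> universal_clique G {x}" using no_universal_clique by blast
  then show thesis using that assms by (auto simp: universal_clique_def clique_def)
qed

lemma C4: "a \<sim> b \<Longrightarrow> b \<sim> c \<Longrightarrow> c \<sim> d \<Longrightarrow> d \<sim> a \<Longrightarrow> a \<noteq> c \<Longrightarrow> b \<noteq> d \<Longrightarrow> a \<sim> c \<or> b \<sim> d"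
  by (rule C4_chord[OF no_C4])

lemma bull_or_hammer_cases:
  assumes "induced_free G bull_graph \<Longrightarrow> P" and "induced_free G hammer_graph \<Longrightarrow> P"
  shows P
  using assms bull_or_hammer by blast

text \<open>
  If \<open>G\<close> has no 5-hole, a vertex off a longer hole cannot have a single neighbour on it. This is why
  5-holes get precedence.
\<close>

definition preferred_hole :: "int \<Rightarrow> (int \<Rightarrow> 'a) \<Rightarrow> bool" where
  "preferred_hole k v \<longleftrightarrow> hole k v \<and> k \<ge> 5 \<and> (k = 5 \<or> (\<forall>w. \<not> hole 5 w))"

lemma preferred_hole_exists: "\<exists>k v. preferred_hole k v"
proof (cases "\<exists>w. hole 5 w")
  case True
  then show ?thesis by (auto simp: preferred_hole_def)
next
  case False
  obtain x where "x \<in> V" using conn by (auto simp: connected_graph_def)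
  obtain y where "y \<in> V" "y \<noteq> x" "\<not> x \<sim> y" using not_universal[OF \<open>x \<in> V\<close>] by blast
  obtain k v where "k \<ge> 4" and h: "hole k v"
    by (rule hole_exists[OF conn no_clique_cutset \<open>x \<in> V\<close> \<open>y \<in> V\<close> \<open>y \<noteq> x\<close>[symmetric] \<open>\<not> x \<sim> y\<close>])
  have "k \<noteq> 4"
  proof
    assume "k = 4"
    then have "v 0 \<sim> v 1" "v 1 \<sim> v 2" "v 2 \<sim> v 3" "v 3 \<sim> v 0" "v 0 \<noteq> v 2" "v 1 \<noteq> v 3"
      "\<not> v 0 \<sim> v 2" "\<not> v 1 \<sim> v 3"
      using h by (simp_all add: hole_def)
    then show False using C4 by blast
  qed
  then show ?thesis using False \<open>k \<ge> 4\<close> h by (auto simp: preferred_hole_def)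
qed

text \<open>
  Local arguments compare indices that differ by a small number. As \<open>k \<ge> 5\<close>, differences up to 3
  are decided by the following two rules, without reduction modulo \<open>k\<close>.
\<close>

lemma preferred_hole_eq: "preferred_hole k v \<Longrightarrow> \<bar>i - j\<bar> < k \<Longrightarrow> v i = v j \<longleftrightarrow> i = j"
  unfolding preferred_hole_def hole_def using zdvd_not_zless[of "\<bar>i - j\<bar>" k] by fastforce

lemma preferred_hole_adj:
  assumes "preferred_hole k v" and "\<bar>i - j\<bar> \<le> k - 2"
  shows "v i \<sim> v j \<longleftrightarrow> \<bar>i - j\<bar> = 1"
proof -
  have "k dvd d \<longleftrightarrow> d = 0" if "\<bar>d\<bar> < k" for d
    using that zdvd_not_zless[of "\<bar>d\<bar>" k] by fastforce
  from this[of "i - j - 1"] this[of "i - j + 1"] show ?thesis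
    using assms by (auto simp: preferred_hole_def hole_def)
qed

lemma preferred_hole_in: "preferred_hole k v \<Longrightarrow> v i \<in> V"
  by (auto simp: preferred_hole_def hole_def)

lemma preferred_hole_k: "preferred_hole k v \<Longrightarrow> k \<ge> 5"
  by (simp add: preferred_hole_def)

lemma preferred_hole_rotate: "preferred_hole k v \<Longrightarrow> preferred_hole k (\<lambda>j. v (i + j))"
  unfolding preferred_hole_def hole_def by (auto simp: algebra_simps)

text \<open>
  Only the places other than \<open>v i\<close> are compared, so that \<open>v i\<close> is a copy of itself. Any other copy is
  adjacent to \<open>v i\<close>, because \<open>G\<close> is \<open>C\<^sub>4\<close>-free.
\<close>

definition copies :: "(int \<Rightarrow> 'a) \<Rightarrow> int \<Rightarrow> 'a set" where
  "copies v i = {x \<in> V. \<forall>j. v j \<noteq> v i \<longrightarrow> x \<noteq> v j \<and> (x \<sim> v j \<longleftrightarrow> v i \<sim> v j)}"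

definition pendants :: "(int \<Rightarrow> 'a) \<Rightarrow> int \<Rightarrow> 'a set" where
  "pendants v i = {x \<in> V - range v. \<forall>j. x \<sim> v j \<longleftrightarrow> v j = v i}"

definition hubs :: "(int \<Rightarrow> 'a) \<Rightarrow> 'a set" where
  "hubs v = {x \<in> V. \<forall>j. x \<sim> v j}"

definition remote :: "(int \<Rightarrow> 'a) \<Rightarrow> 'a set" where
  "remote v = {x \<in> V - range v. \<forall>j. \<not> x \<sim> v j}"

lemma all_shift: "(\<forall>j. P (i + j)) \<longleftrightarrow> (\<forall>j. P j)" for i :: int
  by (metis add.commute diff_add_cancel)

lemma copies_rotate: "copies (\<lambda>j. v (i + j)) m = copies v (i + m)"
  using all_shift[of "\<lambda>j. v j \<noteq> v (i + m) \<longrightarrow> x \<noteq> v j \<and> (x \<sim> v j \<longleftrightarrow> v (i + m) \<sim> v j)" i for x]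
  by (simp add: copies_def)

lemma range_rotate: "range (\<lambda>j. v (i + j)) = range v" for i :: int
  by (auto simp: image_iff) (metis add.commute diff_add_cancel)

lemma pendants_rotate: "pendants (\<lambda>j. v (i + j)) m = pendants v (i + m)"
  using all_shift[of "\<lambda>j. x \<sim> v j \<longleftrightarrow> v j = v (i + m)" i for x]
  by (simp add: pendants_def range_rotate)

text \<open>
  The index 0 is a place where, going round the hole, a run of neighbours of \<open>x\<close> begins. Two
  neighbours at distance 2 force the vertex between them, as \<open>G\<close> is \<open>C\<^sub>4\<close>-free. For \<open>k > 5\<close>, a run of
  length 1 gives a \<open>fork\<^sup>+\<close>, or a 5-hole if \<open>x\<close> sees \<open>u 3\<close>. Every longer run gives a hammer with its
  first two vertices and the two vertices before them. A run of length 2 also gives a bull, and so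
  does a neighbour \<open>u j\<close> with \<open>3 \<le> j \<le> k - 3\<close>, while \<open>u (k - 2) = u (- 2)\<close> would force \<open>u (- 1)\<close>.
\<close>

lemma hole_neighbour_at_start:
  assumes gh: "preferred_hole k u" and x: "x \<in> V" "x \<notin> range u" and 0: "x \<sim> u 0" "\<not> x \<sim> u (- 1)"
  shows "x \<in> copies u 1 \<or> k = 5 \<and> x \<in> pendants u 0"
proof -
  note k = preferred_hole_k[OF gh]
  note [simp] = preferred_hole_adj[OF gh] preferred_hole_eq[OF gh]
  have xn [simp]: "x \<noteq> u j" "u j \<noteq> x" for j using x(2) by auto
  have gap: "x \<sim> u (j + 1)" if "x \<sim> u j" "x \<sim> u (j + 2)" for j
    using C4[of x "u j" "u (j + 1)" "u (j + 2)"] that k by (simp add: adj_commute)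
  have m2: "\<not> x \<sim> u (- 2)" using gap[of "- 2"] 0 by auto
  have "\<exists>r. - 1 \<le> r \<and> r \<le> k - 2 \<and> u j = u r" for j
  proof -
    have "k dvd j - ((j + 1) mod k - 1)"
      by (metis add_diff_cancel_right' diff_diff_eq2 dvd_minus_mod)
    then have "u j = u ((j + 1) mod k - 1)"
      using gh by (simp add: preferred_hole_def hole_def)
    then show ?thesis
      using pos_mod_bound[of k "j + 1"] pos_mod_sign[of k "j + 1"] k
      by (intro exI[of _ "(j + 1) mod k - 1"] conjI) linarith+
  qed
  then obtain r where r: "- 1 \<le> r j" "r j \<le> k - 2" "u j = u (r j)" for j by metis
  have last: "\<not> x \<sim> u (k - 2)"
  proof -
    have "u (k - 2) = u (- 2)" using gh by (simp add: preferred_hole_def hole_def)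
    then show ?thesis using m2 by simp
  qed
  show ?thesis
  proof (cases "x \<sim> u 1")
    case True
    have bull: "induced_free G bull_graph"
    proof (rule bull_or_hammer_cases)
      assume "induced_free G hammer_graph"
      from hammer_chord[OF this, of x "u 1" "u 0" "u (- 1)" "u (- 2)"]
      show ?thesis using True 0 m2 k by (simp add: adj_commute)
    qed
    have 2: "x \<sim> u 2"
    proof (rule ccontr)
      assume "\<not> ?thesis"
      then show False
        using bull_chord[OF bull, of "u 0" "u 1" x "u (- 1)" "u 2"] True 0 k
        by (simp add: adj_commute)
    qed
    have far: "\<not> x \<sim> u j" if "3 \<le> j" "j \<le> k - 2" for j
    proof (cases "j = k - 2")
      case False
      show ?thesis
      proof
        assume "x \<sim> u j"
        then show False
          using bull_chord[OF bull, of "u 0" x "u 1" "u (- 1)" "u j"] True 0 k that False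
          by (simp add: adj_commute)
      qed
    qed (use last in simp)
    have "x \<sim> u j \<longleftrightarrow> u 1 \<sim> u j" if "u j \<noteq> u 1" for j
    proof -
      have "r j \<noteq> 1" using that r(3)[of j] by metis
      then consider "r j = - 1" | "r j = 0" | "r j = 2" | "3 \<le> r j" using r(1)[of j] by linarith
      then show ?thesis
        unfolding r(3)[of j] using 0 2 far[of "r j"] r(2)[of j] k by cases auto
    qed
    then show ?thesis using x by (auto simp: copies_def)
  next
    case False
    have 2: "\<not> x \<sim> u 2" using gap[of 0] 0 False by auto
    have "k = 5"
    proof (rule ccontr)
      assume "k \<noteq> 5"
      then have k6: "k \<ge> 6" and no5: "\<not> (\<exists>w. hole 5 w)"
        using gh by (auto simp: preferred_hole_def)
      show False
      proof (cases "x \<sim> u 3")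
        case True
        have "\<exists>w. hole 5 w"
          by (rule hole_5I[of x "u 0" "u 1" "u 2" "u 3"]) (use True 0 False 2 k6 in \<open>simp_all add: adj_commute\<close>)
        then show False using no5 by blast
      next
        case F: False
        show False
          using fork_plus_chord[OF no_fork_plus, of "u 0" "u (- 1)" x "u 1" "u 2" "u 3"]
            F 0 False 2 k6 by (simp add: adj_commute)
      qed
    qed
    moreover have "x \<sim> u j \<longleftrightarrow> u j = u 0" for j
    proof -
      consider "r j = - 1" | "r j = 0" | "r j = 1" | "r j = 2" | "r j = 3"
        using r(1,2)[of j] \<open>k = 5\<close> by linarith
      then show ?thesis
        unfolding r(3)[of j] using 0 2 False last \<open>k = 5\<close> by cases auto
    qed
    ultimately show ?thesis using x by (auto simp: pendants_def)
  qed
qed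

text \<open>
  Unless \<open>x\<close> is a hub, walking backwards from a neighbour leads to the beginning of a run of
  neighbours, since the hole is periodic.
\<close>

lemma hole_neighbour_trichotomy:
  assumes gh: "preferred_hole k v" and x: "x \<in> V" and "x \<sim> v a"
  shows "x \<in> hubs v \<or> (\<exists>i. x \<in> copies v i) \<or> k = 5 \<and> (\<exists>i. x \<in> pendants v i)"
proof (cases "x \<in> range v")
  case True
  then obtain i where "x = v i" by blast
  then have "x \<in> copies v i" using x by (auto simp: copies_def)
  then show ?thesis by blast
next
  case out: False
  show ?thesis
  proof (cases "x \<in> hubs v")
    case False
    then obtain b where b: "\<not> x \<sim> v b" using x by (auto simp: hubs_def)
    have "\<exists>i. x \<sim> v i \<and> \<not> x \<sim> v (i - 1)"
    proof (rule ccontr)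
      assume "\<not> ?thesis"
      then have down: "x \<sim> v i \<Longrightarrow> x \<sim> v (i - 1)" for i by blast
      have steps: "x \<sim> v (a - int n)" for n
      proof (induction n)
        case (Suc n)
        then show ?case using down[of "a - int n"] by (simp add: algebra_simps)
      qed (use assms(3) in simp)
      define e where "e = \<bar>a - b\<bar>"
      have "b - a \<le> e" by (simp add: e_def)
      moreover have "1 * e \<le> k * e"
        by (rule mult_right_mono) (use preferred_hole_k[OF gh] in \<open>simp_all add: e_def\<close>)
      ultimately have "0 \<le> a - b + k * e" by linarith
      then have "x \<sim> v (b - k * e)" using steps[of "nat (a - b + k * e)"] by (simp add: algebra_simps)
      moreover have "v (b - k * e) = v b"
        using gh by (simp add: preferred_hole_def hole_def)
      ultimately show False using b by simp
    qed
    then obtain i where i: "x \<sim> v i" "\<not> x \<sim> v (i - 1)" by blast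
    have "x \<notin> range (\<lambda>j. v (i + j))" using out by auto
    then show ?thesis
      using hole_neighbour_at_start[OF preferred_hole_rotate[OF gh, of i] x] i
      unfolding copies_rotate pendants_rotate by auto
  qed simp
qed

end

section \<open>The structure around a hole\<close>

locale around_hole = cutset_free +
  fixes k :: int and v :: "int \<Rightarrow> 'a"
  assumes good: "preferred_hole k v"
begin

abbreviation A :: "int \<Rightarrow> 'a set" where "A \<equiv> pendants v"
abbreviation B :: "int \<Rightarrow> 'a set" where "B \<equiv> copies v"
abbreviation D :: "'a set" where "D \<equiv> hubs v"
abbreviation Z :: "'a set" where "Z \<equiv> remote v"

lemma k: "5 \<le> k"
  by (rule preferred_hole_k[OF good])

lemma v_in [simp]: "v i \<in> V"
  by (rule preferred_hole_in[OF good])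

lemmas v_eq [simp] = preferred_hole_eq[OF good]
lemmas v_adj [simp] = preferred_hole_adj[OF good]

lemma A_in: "a \<in> A i \<Longrightarrow> a \<in> V"
  and B_in: "b \<in> B i \<Longrightarrow> b \<in> V"
  and D_in: "d \<in> D \<Longrightarrow> d \<in> V"
  and Z_in: "z \<in> Z \<Longrightarrow> z \<in> V"
  by (simp_all add: pendants_def copies_def hubs_def remote_def)

lemma A_cong: "v i = v j \<Longrightarrow> A i = A j"
  by (simp add: pendants_def)

lemma B_cong: "v i = v j \<Longrightarrow> B i = B j"
  by (simp add: copies_def)

lemma v_period: "v (i + k) = v i"
  using good by (simp add: preferred_hole_def hole_def)

lemma index_mod: "\<exists>r. 0 \<le> r \<and> r < k \<and> v i = v (j + r)"
proof -
  have "k dvd i - (j + (i - j) mod k)"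
    by (metis diff_diff_eq dvd_minus_mod)
  then have "v i = v (j + (i - j) mod k)"
    using good by (simp add: preferred_hole_def hole_def)
  moreover have "0 \<le> (i - j) mod k" "(i - j) mod k < k"
    using k by (auto intro: pos_mod_bound pos_mod_sign)
  ultimately show ?thesis by blast
qed

lemma index_mod_5:
  assumes "k = 5"
  shows "v j = v i \<or> v j = v (i + 1) \<or> v j = v (i + 2) \<or> v j = v (i - 1) \<or> v j = v (i - 2)"
proof -
  have [simp]: "v (i + 3) = v (i - 2)" "v (i + 4) = v (i - 1)"
    using good assms by (simp_all add: preferred_hole_def hole_def)
  obtain r where r: "0 \<le> r" "r < k" "v j = v (i + r)" using index_mod by blast
  consider "r = 0" | "r = 1" | "r = 2" | "r = 3" | "r = 4" using r assms by linarith
  then show ?thesis using r(3) by cases simp_all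
qed

lemma A_v:
  assumes "a \<in> A i" and "\<bar>j - i\<bar> < k"
  shows "a \<sim> v j \<longleftrightarrow> j = i" and "v j \<sim> a \<longleftrightarrow> j = i"
  using assms adj_commute[of "v j" a] by (auto simp: pendants_def)

lemma B_v:
  assumes "b \<in> B i" and "j \<noteq> i" and "\<bar>j - i\<bar> \<le> k - 2"
  shows "b \<sim> v j \<longleftrightarrow> \<bar>j - i\<bar> = 1" and "v j \<sim> b \<longleftrightarrow> \<bar>j - i\<bar> = 1"
proof -
  have "b \<sim> v j \<longleftrightarrow> v i \<sim> v j"
    using assms by (auto simp: copies_def)
  then show "b \<sim> v j \<longleftrightarrow> \<bar>j - i\<bar> = 1"
    using assms by (simp add: abs_minus_commute)
  then show "v j \<sim> b \<longleftrightarrow> \<bar>j - i\<bar> = 1" by (simp add: adj_commute)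
qed

lemma D_v: "d \<in> D \<Longrightarrow> d \<sim> v j" "d \<in> D \<Longrightarrow> v j \<sim> d"
  using adj_commute by (auto simp: hubs_def)

lemma Z_v: "z \<in> Z \<Longrightarrow> \<not> z \<sim> v j" "z \<in> Z \<Longrightarrow> \<not> v j \<sim> z"
  using adj_commute[of _ "v j"] by (auto simp: remote_def)

lemma v_in_B: "v i \<in> B i"
  by (auto simp: copies_def)

lemma v_in_B_iff: "v i \<in> B j \<longleftrightarrow> v i = v j"
  by (auto simp: copies_def)

lemma A_not_v: "a \<in> A i \<Longrightarrow> a \<noteq> v j"
  by (auto simp: pendants_def)

lemma cover: "x \<in> V \<Longrightarrow> x \<in> D \<or> (\<exists>i. x \<in> A i) \<or> (\<exists>i. x \<in> B i) \<or> x \<in> Z"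
proof (cases "\<exists>i. x \<sim> v i")
  case True
  moreover assume "x \<in> V"
  ultimately show ?thesis using hole_neighbour_trichotomy[OF good] by blast
next
  case False
  moreover assume "x \<in> V"
  ultimately show ?thesis
    using v_in_B by (cases "x \<in> range v") (auto simp: remote_def)
qed

lemma B_two_nbrs: "b \<in> B i \<Longrightarrow> b \<sim> v (i - 1) \<and> b \<sim> v (i + 1)"
  using k by (simp add: B_v)

lemma A_not_B: "a \<in> A i \<Longrightarrow> a \<notin> B j"
proof
  assume "a \<in> A i" "a \<in> B j"
  then have "v (j - 1) = v (j + 1)"
    using B_two_nbrs[of a j] by (simp add: pendants_def)
  then show False using k by simp
qed

lemma A_not_D: "a \<in> A i \<Longrightarrow> a \<notin> D"
proof
  assume "a \<in> A i" "a \<in> D"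
  then have "v (i + 1) = v i" by (auto simp: pendants_def hubs_def)
  then show False using k by simp
qed

lemma B_not_D: "b \<in> B i \<Longrightarrow> b \<notin> D"
  using k B_v(1)[of b i "i + 2"] D_v(1)[of b "i + 2"] by auto

lemma Z_not_B: "z \<in> Z \<Longrightarrow> z \<notin> B i"
  using B_two_nbrs Z_v(1) by blast

lemma Z_not_D: "z \<in> Z \<Longrightarrow> z \<notin> D"
  using D_v(1) Z_v(1) by blast

lemma k_eq_5_if_A:
  assumes "a \<in> A i"
  shows "k = 5"
proof -
  have a: "a \<in> V" "a \<sim> v i"
    using k assms A_in by (auto simp: A_v[OF assms])
  show ?thesis
    using hole_neighbour_trichotomy[OF good a(1,2)] A_not_B[OF assms] A_not_D[OF assms] by blast
qed

text \<open>
  In the next lemmas, each application of a chord lemma lists the vertices of the forbidden subgraph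
  that would arise: the two vertices in question and a few vertices of the hole next to them.
\<close>

lemma B_clique:
  assumes "x \<in> B i" "y \<in> B i" "x \<noteq> y"
  shows "x \<sim> y"
  using k C4[of x "v (i - 1)" y "v (i + 1)"] assms(3) by (simp add: B_v[OF assms(1)] B_v[OF assms(2)])

text \<open>
  A copy other than \<open>v i\<close> forms a triangle with \<open>v i\<close> and \<open>v (i + 1)\<close>, and the path along the hole
  from \<open>v (i + 1)\<close> completes it to a hammer. Hence the other alternative, bull-freeness, holds.
\<close>

lemma bull_free_if_proper_copy:
  assumes "b \<in> B i" "b \<noteq> v i"
  shows "induced_free G bull_graph"
proof (rule bull_or_hammer_cases)
  assume "induced_free G hammer_graph"
  from hammer_chord[OF this, of b "v i" "v (i + 1)" "v (i + 2)" "v (i + 3)"]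
  show ?thesis using k B_clique[OF assms(1) v_in_B assms(2)] by (simp add: B_v[OF assms(1)])
qed

lemma B_B_next:
  assumes "x \<in> B i" "y \<in> B (i + 1)"
  shows "x \<sim> y"
proof (cases "x = v i \<or> y = v (i + 1)")
  case True
  then show ?thesis using k by (auto simp: B_v[OF assms(1)] B_v[OF assms(2)])
next
  case False
  then have "y \<sim> v (i + 1)" using B_clique[OF assms(2) v_in_B] by simp
  then show ?thesis
    using k bull_chord[OF bull_free_if_proper_copy[OF assms(1)], of "v (i + 1)" "v (i + 2)" y x "v (i + 3)"] False
    by (simp add: B_v[OF assms(1)] B_v[OF assms(2)] adj_commute[of "v (i + 1)" y])
qed

text \<open>
  For \<open>r = 2\<close> the bull has its horns at \<open>v (j + 3)\<close> and \<open>v (j - 1)\<close>, which are adjacent if \<open>k = 5\<close>. That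
  case is left out because the two copies can change roles, which turns \<open>r\<close> into \<open>5 - 2 = 3\<close>.
\<close>

lemma B_B_apart_aux:
  assumes x: "x \<in> B (j + r)" and y: "y \<in> B j" and r: "2 \<le> r" "r \<le> k - 2" "r = 2 \<longrightarrow> k \<noteq> 5"
  shows "\<not> x \<sim> y"
proof (cases "x = v (j + r) \<or> y = v j")
  case True
  then show ?thesis using k r by (auto simp: B_v[OF x] B_v[OF y])
next
  case False
  have yj: "y \<sim> v j" using False B_clique[OF y v_in_B] by simp
  note [simp] = B_v[OF x] B_v[OF y]
  note bull = bull_chord[OF bull_free_if_proper_copy[OF x]]
  show ?thesis
  proof
    assume xy: "x \<sim> y"
    then have yx: "y \<sim> x" by (simp add: adj_commute)
    consider "r = 2" "k \<ge> 6" | "r = 3" | "r \<ge> 4" using r k by linarith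
    then show False
    proof cases
      case 1
      then show False
        using k bull[of x y "v (j + 1)" "v (j + 3)" "v (j - 1)"] xy False by simp
    next
      case 2
      then have "x \<noteq> v (j + 1)" "y \<noteq> v (j + 2)"
        using x y k v_in_B_iff[of "j + 1" "j + 3"] v_in_B_iff[of "j + 2" j] by auto
      then show False
        using k 2 C4[of x y "v (j + 1)" "v (j + 2)"] xy by simp
    next
      case 3
      then show False
        using k bull[of y "v (j + 1)" "v j" x "v (j + 2)"] xy yx yj False r by simp
    qed
  qed
qed

lemma B_B_apart:
  assumes "x \<in> B i" "y \<in> B j" "v i \<noteq> v j" "\<not> v i \<sim> v j"
  shows "\<not> x \<sim> y"
proof -
  obtain r where r: "0 \<le> r" "r < k" "v i = v (j + r)" using index_mod by blast
  have "r \<noteq> 0" using r assms by auto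
  moreover have "r \<noteq> 1" using r assms k by auto
  moreover have "r \<noteq> k - 1"
  proof
    assume "r = k - 1"
    then have "j + r = (j - 1) + k" by simp
    then have "v i = v (j - 1)" using r(3) v_period[of "j - 1"] by metis
    then show False using assms(4) k by simp
  qed
  ultimately have r': "2 \<le> r" "r \<le> k - 2" using r by linarith+
  have x: "x \<in> B (j + r)" using assms(1) B_cong[OF r(3)] by simp
  show ?thesis
  proof (cases "r = 2 \<and> k = 5")
    case True
    then have "v j = v (i + 3)"
      using good r(3) by (auto simp: preferred_hole_def hole_def algebra_simps)
    then have "y \<in> B (i + 3)" using assms(2) B_cong[of j "i + 3"] by simp
    then show ?thesis
      using B_B_apart_aux[of y i 3 x] assms(1) True by (simp add: adj_commute)
  next
    case False
    then show ?thesis using B_B_apart_aux[OF x assms(2) r'] by blast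
  qed
qed

lemma D_clique:
  assumes "x \<in> D" "y \<in> D" "x \<noteq> y"
  shows "x \<sim> y"
  using k C4[of x "v 0" y "v 2"] assms by (simp add: D_v)

lemma D_B:
  assumes "d \<in> D" "b \<in> B i"
  shows "d \<sim> b"
proof -
  have "d \<noteq> b" using assms B_not_D by blast
  then show ?thesis
    using k C4[of d "v (i - 1)" b "v (i + 1)"] assms(1) by (simp add: D_v B_v[OF assms(2)])
qed

lemma D_A:
  assumes "d \<in> D" "a \<in> A i"
  shows "d \<sim> a"
proof (rule bull_or_hammer_cases)
  assume "induced_free G hammer_graph"
  from hammer_chord[OF this, of "v (i + 2)" "v (i + 3)" d "v i" a]
  show ?thesis using k by (simp add: D_v[OF assms(1)] A_v[OF assms(2)])
next
  assume "induced_free G bull_graph"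
  from bull_chord[OF this, of "v i" d "v (i + 1)" a "v (i + 3)"]
  show ?thesis
    using k by (simp add: D_v[OF assms(1)] A_v[OF assms(2)] adj_commute[of a d])
qed

lemma A_clique:
  assumes "x \<in> A i" "y \<in> A i" "x \<noteq> y"
  shows "x \<sim> y"
  using k fork_plus_chord[OF no_fork_plus, of "v i" x y "v (i + 1)" "v (i + 2)" "v (i + 3)"] assms(3)
  by (simp add: A_v[OF assms(1)] A_v[OF assms(2)])

lemma A_A_next:
  assumes "x \<in> A i" "y \<in> A (i + 1)"
  shows "\<not> x \<sim> y"
  using k C4[of x "v i" "v (i + 1)" y] A_not_v[OF assms(1)] A_not_v[OF assms(2), of i, symmetric]
  by (auto simp: A_v[OF assms(1)] A_v[OF assms(2)] adj_commute[of y x])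

lemma A_A_two:
  assumes "x \<in> A i" "y \<in> A (i + 2)"
  shows "x \<sim> y"
  using k fork_plus_chord[OF no_fork_plus, of "v (i + 2)" y "v (i + 3)" "v (i + 1)" "v i" x]
    A_not_v[OF assms(2)]
  by (simp add: A_v[OF assms(1)] A_v[OF assms(2)] adj_commute[of y x])

lemma A_B_same:
  assumes "a \<in> A i" "b \<in> B i"
  shows "a \<sim> b"
proof (cases "b = v i")
  case False
  then show ?thesis
    using k bull_chord[OF bull_free_if_proper_copy[OF assms(2)], of "v i" "v (i + 1)" b a "v (i + 2)"]
      B_clique[OF v_in_B assms(2)]
    by (simp add: A_v[OF assms(1)] B_v[OF assms(2)])
qed (use k in \<open>simp add: A_v[OF assms(1)]\<close>)

lemma A_B_apart:
  assumes a: "a \<in> A i" and b: "b \<in> B j" and "v i \<noteq> v j"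
  shows "\<not> a \<sim> b"
proof (cases "b = v j")
  case True
  then show ?thesis using a \<open>v i \<noteq> v j\<close> by (simp add: pendants_def)
next
  case False
  note bull = bull_chord[OF bull_free_if_proper_copy[OF b False]]
  have k5: "k = 5" by (rule k_eq_5_if_A[OF a])
  have ne: "a \<noteq> v m" for m by (rule A_not_v[OF a])
  note [simp] = A_v[OF a]
  show ?thesis
  proof
    assume ab: "a \<sim> b"
    then have ba: "b \<sim> a" by (simp add: adj_commute)
    consider "v j = v (i + 1)" | "v j = v (i + 2)" | "v j = v (i - 1)" | "v j = v (i - 2)"
      using index_mod_5[OF k5, of j i] \<open>v i \<noteq> v j\<close>[symmetric] by blast
    then show False
    proof cases
      case 1
      then have b: "b \<in> B (i + 1)" using b B_cong[OF 1] by simp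
      show False
        using k bull[of "v i" b a "v (i - 1)" "v (i + 2)"] ab ba by (simp add: B_v[OF b])
    next
      case 2
      then have b: "b \<in> B (i + 2)" using b B_cong[OF 2] by simp
      have "v i \<noteq> b" using False 2 \<open>v i \<noteq> v j\<close> b v_in_B_iff[of i "i + 2"] by auto
      then show False
        using k C4[of a "v i" "v (i + 1)" b] ba ne by (simp add: B_v[OF b])
    next
      case 3
      then have b: "b \<in> B (i - 1)" using b B_cong[OF 3] by simp
      show False
        using k bull[of "v i" b a "v (i + 1)" "v (i - 2)"] ab ba by (simp add: B_v[OF b])
    next
      case 4
      then have b: "b \<in> B (i - 2)" using b B_cong[OF 4] by simp
      have "v i \<noteq> b" using False 4 \<open>v i \<noteq> v j\<close> b v_in_B_iff[of i "i - 2"] by auto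
      then show False
        using k C4[of a "v i" "v (i - 1)" b] ba ne by (simp add: B_v[OF b])
    qed
  qed
qed

lemma Z_B:
  assumes "z \<in> Z" "b \<in> B i"
  shows "\<not> z \<sim> b"
proof (cases "b = v i")
  case False
  then show ?thesis
    using k bull_chord[OF bull_free_if_proper_copy[OF assms(2)], of b "v (i + 1)" "v i" z "v (i + 2)"]
      B_clique[OF assms(2) v_in_B False]
    by (auto simp: Z_v[OF assms(1)] B_v[OF assms(2)] adj_commute[of z b])
qed (simp add: Z_v[OF assms(1)])

text \<open>
  The pendants \<open>a\<close> and \<open>b\<close> are adjacent. If \<open>z\<close> sees one of them only, this one is the centre of a
  \<open>fork\<^sup>+\<close> with long leg along the hole; if \<open>z\<close> sees both, the triangle extends to a hammer and to
  a bull.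
\<close>

lemma Z_A:
  assumes z: "z \<in> Z" and a: "a \<in> A i" and b: "b \<in> A (i + 2)"
  shows "\<not> z \<sim> a" and "\<not> z \<sim> b"
proof -
  have "a \<sim> v i" "b \<sim> v (i + 2)"
    using k by (simp_all add: A_v[OF a] A_v[OF b])
  then have ne: "z \<noteq> a" "z \<noteq> b" using Z_v(1)[OF z] by blast+
  have ab: "a \<sim> b" "b \<sim> a" using A_A_two[OF a b] by (simp_all add: adj_commute)
  note k5 = k_eq_5_if_A[OF a]
  note [simp] = A_v[OF a] A_v[OF b] Z_v[OF z] k5 ab
  have 5: "v (i + 3) = v (i - 2)" "v (i + 4) = v (i - 1)"
    using good k5 by (simp_all add: preferred_hole_def hole_def)
  have both: "\<not> (z \<sim> a \<and> z \<sim> b)"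
  proof (rule bull_or_hammer_cases)
    assume "induced_free G hammer_graph"
    from hammer_chord[OF this, of z b a "v i" "v (i - 1)"]
    show ?thesis using 5 by (auto simp: A_v(1)[OF b, of "i + 4", unfolded 5])
  next
    assume "induced_free G bull_graph"
    from bull_chord[OF this, of a b z "v i" "v (i + 2)"]
    show ?thesis by (auto simp: adj_commute[of _ z])
  qed
  have "\<not> z \<sim> a" if "\<not> z \<sim> b"
    using k fork_plus_chord[OF no_fork_plus, of a z b "v i" "v (i - 1)" "v (i - 2)"] that
      A_v[OF b, of "i + 3"] A_v[OF b, of "i + 4"] 5
    by (auto simp: adj_commute[of _ z] ne)
  moreover have "\<not> z \<sim> b" if "\<not> z \<sim> a"
    using k fork_plus_chord[OF no_fork_plus, of b z a "v (i + 2)" "v (i + 3)" "v (i + 4)"] that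
    by (auto simp: adj_commute[of _ z] ne)
  ultimately show "\<not> z \<sim> a" "\<not> z \<sim> b" using both by blast+
qed

text \<open>
  Let \<open>T\<close> be the set of places \<open>i\<close> with pendants that have none at \<open>i + 2\<close> and \<open>i - 2\<close>. Such
  pendants and the remote vertices only see each other, the hubs, and the copies of their places.
  Any two places in \<open>T\<close> are equal or consecutive, so these copies and the hubs form a clique,
  which would be a cutset unless there are no such vertices at all.
\<close>

lemma no_isolated_pendants_no_remote:
  shows "Z = {}" and "A i \<noteq> {} \<Longrightarrow> A (i + 2) \<noteq> {} \<or> A (i - 2) \<noteq> {}"
proof -
  define T where "T = {i. A i \<noteq> {} \<and> A (i + 2) = {} \<and> A (i - 2) = {}}"
  define K where "K = (\<Union>i \<in> T. B i) \<union> D"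
  define X where "X = (\<Union>i \<in> T. A i) \<union> Z"
  define Y where "Y = V - X - K"
  have T_k: "k = 5" if "i \<in> T" for i using that k_eq_5_if_A by (auto simp: T_def)
  have T_close: "v j = v i \<or> v j = v (i + 1) \<or> v j = v (i - 1)"
    if "i \<in> T" "A j \<noteq> {}" for i j
  proof -
    have "A (i + 2) = {}" "A (i - 2) = {}" using that(1) by (simp_all add: T_def)
    then have "v j \<noteq> v (i + 2)" "v j \<noteq> v (i - 2)" using that(2) A_cong by metis+
    then show ?thesis using index_mod_5[OF T_k[OF that(1)], of j i] by blast
  qed
  have T_cong: "j \<in> T" if "i \<in> T" "v j = v i" for i j
  proof -
    have "v (j + 2) = v (i + 2)" "v (j - 2) = v (i - 2)"
      using that good by (simp_all add: preferred_hole_def hole_def)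
    then have "A j = A i" "A (j + 2) = A (i + 2)" "A (j - 2) = A (i - 2)"
      using that(2) A_cong by metis+
    then show ?thesis using that(1) by (simp add: T_def)
  qed
  have BB: "x \<sim> y" if "x \<in> B i" "y \<in> B j" "i \<in> T" "j \<in> T" "x \<noteq> y" for x y i j
  proof -
    have "A j \<noteq> {}" using that by (simp add: T_def)
    from T_close[OF that(3) this] show ?thesis
    proof (elim disjE)
      assume "v j = v i"
      from B_cong[OF this] show ?thesis using that B_clique by blast
    next
      assume "v j = v (i + 1)"
      from B_cong[OF this] show ?thesis using that B_B_next by blast
    next
      assume "v j = v (i - 1)"
      from B_cong[OF this] have "y \<in> B (i - 1)" using that by blast
      then show ?thesis using that B_B_next[of y "i - 1" x] by (simp add: adj_commute)
    qed
  qed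
  have "clique G K"
    unfolding clique_def
  proof (intro conjI ballI impI)
    show "K \<subseteq> V" using B_in D_in by (auto simp: K_def)
    fix x y assume xy: "x \<in> K" "y \<in> K" "x \<noteq> y"
    then show "x \<sim> y"
      unfolding K_def using BB D_clique D_B adj_commute by blast
  qed
  have apart: "\<not> x \<sim> y" if xX: "x \<in> X" and yY: "y \<in> Y" for x y
  proof
    assume xy: "x \<sim> y"
    have y: "y \<in> V" "y \<notin> D" "y \<notin> Z" "\<And>i. i \<in> T \<Longrightarrow> y \<notin> A i \<and> y \<notin> B i"
      using yY by (auto simp: Y_def X_def K_def)
    consider (A) i where "i \<in> T" "x \<in> A i" | (Z) "x \<in> Z" using xX by (auto simp: X_def)
    then show False
    proof cases
      case A
      have "y \<notin> B j" for j
        using A_B_apart[OF A(2), of y j] y(4)[OF A(1)] B_cong[of i j] xy by blast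
      then obtain j where j: "y \<in> A j" using cover[OF y(1)] y by blast
      then have "A j \<noteq> {}" by blast
      from T_close[OF A(1) this] show False
      proof (elim disjE)
        assume "v j = v i"
        then show False using y(4)[OF T_cong[OF A(1)]] j by blast
      next
        assume "v j = v (i + 1)"
        from A_cong[OF this] show False using A_A_next[OF A(2)] j xy by blast
      next
        assume "v j = v (i - 1)"
        from A_cong[OF this] have "y \<in> A (i - 1)" using j by blast
        then show False using A_A_next[of y "i - 1" x] A xy by (simp add: adj_commute)
      qed
    next
      case Z
      then obtain j where j: "y \<in> A j" using cover[OF y(1)] y Z_B xy by blast
      have "A (j + 2) = {}" using Z_A(1)[OF Z j] xy by blast
      moreover have "A (j - 2) = {}" using Z_A(2)[OF Z, of _ "j - 2" y] j xy by auto
      ultimately have "j \<in> T" using j by (auto simp: T_def)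
      then show False using y(4) j by blast
    qed
  qed
  have "X = {}"
  proof (rule ccontr)
    assume "X \<noteq> {}"
    \<comment> \<open>such a \<open>v m\<close> is on the far side of the cutset\<close>
    have "\<exists>m. \<forall>j \<in> T. v m \<noteq> v j"
    proof (cases "T = {}")
      case False
      then obtain i where i: "i \<in> T" by blast
      have "v (i + 2) \<noteq> v j" if "j \<in> T" for j
      proof
        assume "v (i + 2) = v j"
        then have "A (i + 2) = A j" by (rule A_cong)
        then show False using that i by (simp add: T_def)
      qed
      then show ?thesis by blast
    qed simp
    then obtain m where m: "\<forall>j \<in> T. v m \<noteq> v j" by blast
    have "v m \<notin> D" using D_v(1)[of "v m" m] by auto
    then have "v m \<in> Y"
      using m by (auto simp: Y_def X_def K_def v_in_B_iff remote_def pendants_def)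
    have "X \<inter> K = {}"
      unfolding X_def K_def using A_not_B A_not_D Z_not_B Z_not_D by blast
    moreover have "X \<subseteq> V" using A_in Z_in by (auto simp: X_def)
    then have "V = X \<union> K \<union> Y" "X \<inter> Y = {}" "K \<inter> Y = {}"
      using \<open>clique G K\<close> by (auto simp: Y_def clique_def)
    moreover have "Y \<noteq> {}" using \<open>v m \<in> Y\<close> by blast
    ultimately have "separation X K Y"
      using \<open>X \<noteq> {}\<close> apart by (simp add: separation_def)
    then show False
      using clique_cutset_if_separation[OF conn \<open>clique G K\<close>] no_clique_cutset by blast
  qed
  then show "Z = {}" by (simp add: X_def)
  show "A (i + 2) \<noteq> {} \<or> A (i - 2) \<noteq> {}" if "A i \<noteq> {}"
    using that \<open>X = {}\<close> by (auto simp: X_def T_def)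
qed

lemma no_hubs: "D = {}"
proof (rule ccontr)
  assume "D \<noteq> {}"
  then obtain d where d: "d \<in> D" by blast
  obtain y where y: "y \<in> V" "y \<noteq> d" "\<not> d \<sim> y" by (rule not_universal[OF D_in[OF d]])
  then show False
    using cover[OF y(1)] no_isolated_pendants_no_remote(1) D_clique[OF d] D_A[OF d] D_B[OF d] by blast
qed

lemma cover_A_B: "V = (\<Union>i. A i) \<union> (\<Union>i. B i)"
proof
  show "V \<subseteq> (\<Union>i. A i) \<union> (\<Union>i. B i)"
    using no_hubs no_isolated_pendants_no_remote(1) by (auto dest!: cover)
qed (auto intro: A_in B_in)

lemma v_adj_iff: "v i \<sim> v j \<longleftrightarrow> v j = v (i + 1) \<or> v j = v (i - 1)"
proof -
  have "j - (i - 1) = - (i - j - 1)" "j - (i + 1) = - (i - j + 1)" by simp_all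
  then have "k dvd j - (i - 1) \<longleftrightarrow> k dvd i - j - 1" "k dvd j - (i + 1) \<longleftrightarrow> k dvd i - j + 1"
    by (simp_all only: dvd_minus_iff)
  moreover have "v j = v m \<longleftrightarrow> k dvd j - m" "v i \<sim> v j \<longleftrightarrow> k dvd i - j - 1 \<or> k dvd i - j + 1" for m
    using good unfolding preferred_hole_def hole_def by blast+
  ultimately show ?thesis by blast
qed

lemma B_B_adj:
  assumes "v i \<sim> v j" and "x \<in> B i" "y \<in> B j"
  shows "x \<sim> y"
proof -
  consider "v j = v (i + 1)" | "v j = v (i - 1)" using assms(1) v_adj_iff by blast
  then show ?thesis
  proof cases
    case 1
    from B_cong[OF this] show ?thesis using assms B_B_next by blast
  next
    case 2
    from B_cong[OF this] have "y \<in> B (i - 1)" using assms by blast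
    then show ?thesis using assms B_B_next[of y "i - 1" x] by (simp add: adj_commute)
  qed
qed

lemma B_disjoint:
  assumes "v i \<noteq> v j"
  shows "B i \<inter> B j = {}"
proof (rule ccontr)
  assume "B i \<inter> B j \<noteq> {}"
  then obtain x where x: "x \<in> B i" "x \<in> B j" by blast
  have "x \<noteq> v i" using x v_in_B_iff assms by auto
  then have "x \<sim> v i" using B_clique[OF x(1) v_in_B] by blast
  then have "v j \<sim> v i" using x(2) assms by (auto simp: copies_def)
  then consider "v j = v (i + 1)" | "v j = v (i - 1)" using v_adj_iff[of i j] adj_commute by blast
  then show False
  proof cases
    case 1
    from B_cong[OF this] have "x \<in> B (i + 1)" using x by blast
    then show False using k B_v(1)[of x "i + 1" "i - 1"] B_two_nbrs[OF x(1)] by simp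
  next
    case 2
    from B_cong[OF this] have "x \<in> B (i - 1)" using x by blast
    then show False using k B_v(1)[of x "i - 1" "i + 1"] B_two_nbrs[OF x(1)] by simp
  qed
qed

lemma A_disjoint: "v i \<noteq> v j \<Longrightarrow> A i \<inter> A j = {}"
  by (auto simp: pendants_def)

lemma A_A_adj:
  assumes "x \<in> A i" "y \<in> A j" "v i \<noteq> v j"
  shows "x \<sim> y \<longleftrightarrow> \<not> v i \<sim> v j"
proof -
  consider "v j = v (i + 1)" | "v j = v (i - 1)" | "v j = v (i + 2)" | "v j = v (i - 2)"
    using index_mod_5[OF k_eq_5_if_A[OF assms(1)], of j i] assms(3)[symmetric] by blast
  then show ?thesis
  proof cases
    case 1
    from A_cong[OF this] have "y \<in> A (i + 1)" using assms by blast
    then show ?thesis using A_A_next[OF assms(1)] 1 k by auto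
  next
    case 2
    from A_cong[OF this] have "y \<in> A (i - 1)" using assms by blast
    then show ?thesis using A_A_next[of y "i - 1" x] assms(1) 2 k by (auto simp: adj_commute[of x])
  next
    case 3
    from A_cong[OF this] have "y \<in> A (i + 2)" using assms by blast
    then show ?thesis using A_A_two[OF assms(1)] 3 k by auto
  next
    case 4
    from A_cong[OF this] have "y \<in> A (i - 2)" using assms by blast
    then show ?thesis using A_A_two[of y "i - 2" x] assms(1) 4 k by (auto simp: adj_commute[of x])
  qed
qed

lemma B_singleton:
  assumes "induced_free G hammer_graph"
  shows "B i = {v i}"
proof -
  have "b = v i" if "b \<in> B i" for b
  proof (rule ccontr)
    assume "b \<noteq> v i"
    then show False
      using k hammer_chord[OF assms, of b "v i" "v (i + 1)" "v (i + 2)" "v (i + 3)"]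
        B_clique[OF that v_in_B] by (simp add: B_v[OF that])
  qed
  then show ?thesis using v_in_B by blast
qed

lemma A_at_most_one:
  assumes "induced_free G hammer_graph" and "x \<in> A i" "y \<in> A i"
  shows "x = y"
proof (rule ccontr)
  assume "x \<noteq> y"
  then show False
    using k hammer_chord[OF assms(1), of x y "v i" "v (i + 1)" "v (i + 2)"] A_clique[OF assms(2,3)]
    by (simp add: A_v[OF assms(2)] A_v[OF assms(3)])
qed

end

section \<open>Recognising the graph\<close>

lemma adjacent_extend_graph:
  "adjacent (extend_graph G W E) u v \<longleftrightarrow> adjacent G u v \<or> {u, v} \<in> E"
  by (simp add: adjacent_def extend_graph_def)

lemma verts_C5: "verts (cycle_graph 5) = {1, 2, 3, 4, 5}"
  by (auto simp: verts_cycle_graph)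

lemma verts_F:
  "verts F2' = {1, 2, 3, 4, 5, 6, 8}"
  "verts F3 = {1, 2, 3, 4, 5, 6, 8, 9}"
  "verts F4 = {1, 2, 3, 4, 5, 6, 8, 9, 10}"
  "verts F5 = {1, 2, 3, 4, 5, 6, 7, 8, 9, 10}"
  by (auto simp: F2'_def F3_def F4_def F5_def extend_graph_def verts_cycle_graph)

text \<open>
  All graphs that arise from a 5-hole are induced subgraphs of the Petersen graph, so the adjacency
  of bags has to be compared with that graph only.
\<close>

lemma family_in_Petersen:
  assumes "F \<in> {cycle_graph 5, F2', F3, F4, F5}" and "i \<in> verts F" "j \<in> verts F"
  shows "adjacent F i j \<longleftrightarrow> adjacent F5 i j"
proof -
  have "\<forall>i \<in> verts F. \<forall>j \<in> verts F. adjacent F i j \<longleftrightarrow> adjacent F5 i j"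
    if "F = cycle_graph 5"
    unfolding that verts_C5
    by (simp add: F5_def adjacent_extend_graph adjacent_cycle_graph_iff doubleton_eq_iff)
  moreover have "\<forall>i \<in> verts F. \<forall>j \<in> verts F. adjacent F i j \<longleftrightarrow> adjacent F5 i j"
    if "F = F2'"
    unfolding that verts_F
    by (simp add: F2'_def F5_def adjacent_extend_graph adjacent_cycle_graph_iff doubleton_eq_iff)
  moreover have "\<forall>i \<in> verts F. \<forall>j \<in> verts F. adjacent F i j \<longleftrightarrow> adjacent F5 i j"
    if "F = F3"
    unfolding that verts_F
    by (simp add: F3_def F5_def adjacent_extend_graph adjacent_cycle_graph_iff doubleton_eq_iff)
  moreover have "\<forall>i \<in> verts F. \<forall>j \<in> verts F. adjacent F i j \<longleftrightarrow> adjacent F5 i j"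
    if "F = F4"
    unfolding that verts_F
    by (simp add: F4_def F5_def adjacent_extend_graph adjacent_cycle_graph_iff doubleton_eq_iff)
  ultimately show ?thesis using assms by blast
qed

lemma adjacent_F5:
  assumes "i \<in> {1..5}" and "j \<in> {1..5}"
  shows "adjacent F5 i j \<longleftrightarrow> j = i + 1 \<or> i = j + 1 \<or> i = 1 \<and> j = 5 \<or> i = 5 \<and> j = 1"
    and "adjacent F5 (5 + i) (5 + j) \<longleftrightarrow> i \<noteq> j \<and> \<not> adjacent F5 i j"
    and "adjacent F5 i (5 + j) \<longleftrightarrow> i = j"
    and "adjacent F5 (5 + i) j \<longleftrightarrow> i = j"
proof -
  have *: "{1..5::nat} = {1, 2, 3, 4, 5}" by auto
  have "\<forall>i \<in> {1..5}. \<forall>j \<in> {1..5}.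
    (adjacent F5 i j \<longleftrightarrow> j = i + 1 \<or> i = j + 1 \<or> i = 1 \<and> j = 5 \<or> i = 5 \<and> j = 1) \<and>
    (adjacent F5 (5 + i) (5 + j) \<longleftrightarrow> i \<noteq> j \<and> \<not> adjacent F5 i j) \<and>
    (adjacent F5 i (5 + j) \<longleftrightarrow> i = j) \<and> (adjacent F5 (5 + i) j \<longleftrightarrow> i = j)"
    unfolding * by (simp add: F5_def adjacent_extend_graph adjacent_cycle_graph_iff doubleton_eq_iff)
  then show "adjacent F5 i j \<longleftrightarrow> j = i + 1 \<or> i = j + 1 \<or> i = 1 \<and> j = 5 \<or> i = 5 \<and> j = 1"
    and "adjacent F5 (5 + i) (5 + j) \<longleftrightarrow> i \<noteq> j \<and> \<not> adjacent F5 i j"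
    and "adjacent F5 i (5 + j) \<longleftrightarrow> i = j"
    and "adjacent F5 (5 + i) j \<longleftrightarrow> i = j"
    using assms by blast+
qed

lemma iso_if_singleton_blowup:
  assumes blowup: "clique_blowup_via G F bag" and single: "\<forall>i \<in> verts F. \<exists>x. bag i = {x}"
    and loopless: "\<forall>i \<in> verts F. \<not> adjacent F i i" "\<forall>x \<in> verts G. \<not> adjacent G x x"
  shows "G \<cong>\<^sub>g F"
proof -
  obtain f where f: "\<forall>i \<in> verts F. bag i = {f i}" using single by metis
  have "F \<cong>\<^sub>g G"
    unfolding graph_iso_def
  proof (intro exI[of _ f] conjI ballI)
    have "inj_on f (verts F)"
    proof (rule inj_onI, rule ccontr)
      fix i j assume ij: "i \<in> verts F" "j \<in> verts F" "f i = f j" "i \<noteq> j"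
      then have "bag i \<inter> bag j = {}" using blowup unfolding clique_blowup_via_def by blast
      then show False using f ij by simp
    qed
    moreover have "f ` verts F = verts G"
      using blowup f unfolding clique_blowup_via_def by auto
    ultimately show "bij_betw f (verts F) (verts G)" by (simp add: bij_betw_def)
    fix i j assume ij: "i \<in> verts F" "j \<in> verts F"
    show "adjacent F i j \<longleftrightarrow> adjacent G (f i) (f j)"
    proof (cases "i = j")
      case True
      have "f i \<in> verts G" using \<open>f ` verts F = verts G\<close> ij by blast
      then show ?thesis using True loopless ij by simp
    next
      case False
      then have "if adjacent F i j then \<forall>x \<in> bag i. \<forall>y \<in> bag j. adjacent G x y
         else \<forall>x \<in> bag i. \<forall>y \<in> bag j. \<not> adjacent G x y"
        using blowup ij unfolding clique_blowup_via_def by blast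
      then show ?thesis using f ij by (simp split: if_splits)
    qed
  qed
  then show ?thesis by (rule graph_iso_sym)
qed

context around_hole
begin

text \<open>
  The bull and the hammer case are treated together: the bags are the same, and if \<open>G\<close> is
  hammer-free they are singletons.
\<close>

definition tight_blowup :: "nat ugraph \<Rightarrow> bool" where
  "tight_blowup F \<longleftrightarrow> (\<exists>bag. clique_blowup_via G F bag \<and> (\<forall>i \<in> verts F. bag i \<noteq> {}) \<and>
     (induced_free G hammer_graph \<longrightarrow> (\<forall>i \<in> verts F. \<exists>x. bag i = {x})))"

lemma tight_blowup_if_long_hole:
  assumes "k \<noteq> 5"
  shows "tight_blowup (cycle_graph (nat k))"
proof -
  define bag where "bag i = B (int i)" for i
  have A_empty: "A i = {}" for i using k_eq_5_if_A assms by blast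
  have v_neq: "v (int i) \<noteq> v (int j)" if "i \<in> {1..nat k}" "j \<in> {1..nat k}" "i \<noteq> j" for i j
    using that by auto
  have adj: "adjacent (cycle_graph (nat k)) i j \<longleftrightarrow> v (int i) \<sim> v (int j)"
    if "i \<in> {1..nat k}" "j \<in> {1..nat k}" for i j
  proof (cases "\<bar>int i - int j\<bar> \<le> k - 2")
    case True
    then have "\<not> (i = 1 \<and> j = nat k)" "\<not> (i = nat k \<and> j = 1)" using k by auto
    moreover have "j = i + 1 \<or> i = j + 1 \<longleftrightarrow> \<bar>int i - int j\<bar> = 1" by linarith
    ultimately show ?thesis
      using v_adj[OF True] adjacent_cycle_graph[OF that] by blast
  next
    case False
    moreover have "1 \<le> int i" "1 \<le> int j" "int i \<le> k" "int j \<le> k" using that by auto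
    ultimately have ends: "int i = k \<and> int j = 1 \<or> int i = 1 \<and> int j = k" by linarith
    then have "i = nat k \<and> j = 1 \<or> i = 1 \<and> j = nat k" by linarith
    then have "adjacent (cycle_graph (nat k)) i j" using adjacent_cycle_graph[OF that] by blast
    moreover have "v k = v 0" using v_period[of 0] by simp
    then have "v k \<sim> v 1" "v 1 \<sim> v k" using k by simp_all
    ultimately show ?thesis using ends by metis
  qed
  have "clique_blowup_via G (cycle_graph (nat k)) bag"
    unfolding clique_blowup_via_def verts_cycle_graph
  proof (intro conjI ballI impI)
    show "V = (\<Union>i \<in> {1..nat k}. bag i)"
    proof
      show "V \<subseteq> (\<Union>i \<in> {1..nat k}. bag i)"
      proof
        fix x assume "x \<in> V"
        then obtain j where j: "x \<in> B j" using cover_A_B A_empty by auto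
        obtain r where r: "0 \<le> r" "r < k" "v j = v (1 + r)" using index_mod by blast
        have "x \<in> bag (nat (1 + r))" using j r B_cong[OF r(3)] by (simp add: bag_def)
        moreover have "nat (1 + r) \<in> {1..nat k}" using r by auto
        ultimately show "x \<in> (\<Union>i \<in> {1..nat k}. bag i)" by blast
      qed
    qed (use B_in in \<open>auto simp: bag_def\<close>)
  next
    fix i show "clique G (bag i)"
      using B_in B_clique by (auto simp: clique_def bag_def)
  next
    fix i j assume ij: "i \<in> {1..nat k}" "j \<in> {1..nat k}" "i \<noteq> j"
    show "bag i \<inter> bag j = {}" using B_disjoint[OF v_neq[OF ij]] by (simp add: bag_def)
    show "if adjacent (cycle_graph (nat k)) i j
       then \<forall>x \<in> bag i. \<forall>y \<in> bag j. x \<sim> y else \<forall>x \<in> bag i. \<forall>y \<in> bag j. \<not> x \<sim> y"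
      using adj[OF ij(1,2)] B_B_adj B_B_apart v_neq[OF ij] by (auto simp: bag_def)
  qed
  moreover have "bag i \<noteq> {}" for i using v_in_B by (auto simp: bag_def)
  ultimately show ?thesis
    unfolding tight_blowup_def using B_singleton by (intro exI[of _ bag]) (auto simp: bag_def)
qed

text \<open>
  The bags of the outer vertices are the sets \<open>B i\<close>, those of the inner vertices are the nonempty
  sets \<open>A i\<close>. The shift \<open>s\<close> turns the hole so that the places with pendants become those of \<open>F\<close>.
\<close>

lemma tight_blowup_if_5_hole:
  assumes k5: "k = 5" and F: "F \<in> {cycle_graph 5, F2', F3, F4, F5}"
    and pend: "\<And>n. n \<in> {1..5} \<Longrightarrow> 5 + n \<in> verts F \<longleftrightarrow> A (int n + s) \<noteq> {}"
  shows "tight_blowup F"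
proof -
  define bag where "bag n = (if n \<le> 5 then B (int n + s) else A (int n - 5 + s))" for n
  have split: "(n \<in> {1..5} \<and> bag n = B (int n + s)) \<or>
      (\<exists>m \<in> {1..5}. n = 5 + m \<and> bag n = A (int m + s))" if "n \<in> verts F" for n
  proof -
    have "n \<in> verts F5" using that F by (auto simp: verts_F verts_C5)
    then have "n \<in> {1..5} \<or> n - 5 \<in> {1..5} \<and> n = 5 + (n - 5)" by (auto simp: verts_F)
    then show ?thesis
      by (elim disjE) (auto simp: bag_def intro!: bexI[of _ "n - 5"])
  qed
  have low: "n \<in> verts F" if "n \<in> {1..5}" for n
  proof -
    have "{1..5::nat} = {1, 2, 3, 4, 5}" by auto
    then show ?thesis using that F by (auto simp: verts_F verts_C5)
  qed
  have v_neq: "v (int i + s) \<noteq> v (int j + s)" if "i \<in> {1..5}" "j \<in> {1..5}" "i \<noteq> j" for i j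
    using that k5 by auto
  have v_adj': "v (int i + s) \<sim> v (int j + s) \<longleftrightarrow> adjacent F5 i j"
    if "i \<in> {1..5}" "j \<in> {1..5}" for i j
  proof (cases "\<bar>int i - int j\<bar> \<le> k - 2")
    case True
    then have "\<not> (i = 1 \<and> j = 5)" "\<not> (i = 5 \<and> j = 1)" using k5 by auto
    moreover have "j = i + 1 \<or> i = j + 1 \<longleftrightarrow> \<bar>int i + s - (int j + s)\<bar> = 1" by linarith
    ultimately show ?thesis
      using v_adj[of "int i + s" "int j + s"] True adjacent_F5(1)[OF that] by auto
  next
    case False
    moreover have "1 \<le> i" "1 \<le> j" "i \<le> 5" "j \<le> 5" using that by auto
    ultimately have ends: "i = 5 \<and> j = 1 \<or> i = 1 \<and> j = 5" using k5 by linarith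
    then have "adjacent F5 i j" using adjacent_F5(1)[OF that] by blast
    moreover have "v (5 + s) = v s" using v_period[of s] k5 by (simp add: add.commute)
    then have "v (5 + s) \<sim> v (1 + s)" "v (1 + s) \<sim> v (5 + s)" using k by simp_all
    moreover have "int i = 5 \<and> int j = 1 \<or> int i = 1 \<and> int j = 5" using ends by auto
    ultimately show ?thesis by metis
  qed
  have "clique_blowup_via G F bag"
    unfolding clique_blowup_via_def
  proof (intro conjI ballI impI)
    show "V = (\<Union>i \<in> verts F. bag i)"
    proof
      show "V \<subseteq> (\<Union>i \<in> verts F. bag i)"
      proof
        fix x assume "x \<in> V"
        then obtain j where j: "x \<in> B j \<or> x \<in> A j" using cover_A_B by auto
        obtain r where r: "0 \<le> r" "r < k" "v j = v (1 + s + r)" using index_mod by blast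
        define n where "n = nat (1 + r)"
        have n: "n \<in> {1..5}" "1 + s + r = int n + s" using r k5 by (auto simp: n_def)
        have vn: "v j = v (int n + s)" using r(3) n(2) by simp
        from j show "x \<in> (\<Union>i \<in> verts F. bag i)"
        proof
          assume "x \<in> B j"
          then have "x \<in> bag n" using n(1) B_cong[OF vn] by (simp add: bag_def)
          then show ?thesis using low[OF n(1)] by blast
        next
          assume "x \<in> A j"
          then have "x \<in> A (int n + s)" using A_cong[OF vn] by simp
          then have "5 + n \<in> verts F" "x \<in> bag (5 + n)"
            using pend[OF n(1)] n(1) by (auto simp: bag_def)
          then show ?thesis by blast
        qed
      qed
    qed (use A_in B_in in \<open>auto simp: bag_def\<close>)
  next
    fix i show "clique G (bag i)"
      using A_in B_in A_clique B_clique by (auto simp: clique_def bag_def)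
  next
    fix i j assume ij: "i \<in> verts F" "j \<in> verts F" "i \<noteq> j"
    have AB: "A a \<inter> B b = {}" for a b using A_not_B by blast
    note F_F5 = family_in_Petersen[OF F ij(1,2)]
    have BA: "y \<sim> x \<longleftrightarrow> v a = v b" if "x \<in> A a" "y \<in> B b" for x y a b
      using A_B_same[OF that(1)] A_B_apart[OF that] that B_cong[of a b] adj_commute[of x y] by blast
    from split[OF ij(1)] split[OF ij(2)]
    have "bag i \<inter> bag j = {} \<and> (\<forall>x \<in> bag i. \<forall>y \<in> bag j. x \<sim> y \<longleftrightarrow> adjacent F i j)"
    proof (elim disjE conjE bexE)
      assume n: "i \<in> {1..5}" "j \<in> {1..5}" and b: "bag i = B (int i + s)" "bag j = B (int j + s)"
      note ne = v_neq[OF n ij(3)]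
      show ?thesis
        using B_disjoint[OF ne] B_B_adj[of "int i + s" "int j + s"] B_B_apart[OF _ _ ne]
          v_adj'[OF n] F_F5 by (auto simp: b)
    next
      fix m assume n: "i \<in> {1..5}" "m \<in> {1..5}" and j: "j = 5 + m"
        and b: "bag i = B (int i + s)" "bag j = A (int m + s)"
      have "v (int m + s) = v (int i + s) \<longleftrightarrow> i = m" using v_neq[OF n] by metis
      then have "x \<sim> y \<longleftrightarrow> i = m" if "x \<in> bag i" "y \<in> bag j" for x y
        using BA[of y "int m + s" x "int i + s"] that by (simp add: b)
      moreover have "adjacent F i j \<longleftrightarrow> i = m" using adjacent_F5(3)[OF n] F_F5 j by simp
      moreover have "bag i \<inter> bag j = {}" using AB[of "int m + s" "int i + s"] b by auto
      ultimately show ?thesis by blast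
    next
      fix m assume n: "m \<in> {1..5}" "j \<in> {1..5}" and i: "i = 5 + m"
        and b: "bag i = A (int m + s)" "bag j = B (int j + s)"
      have "v (int m + s) = v (int j + s) \<longleftrightarrow> m = j" using v_neq[OF n] by metis
      then have "x \<sim> y \<longleftrightarrow> m = j" if "x \<in> bag i" "y \<in> bag j" for x y
        using BA[of x "int m + s" y "int j + s"] that adj_commute[of x y] by (simp add: b)
      moreover have "adjacent F i j \<longleftrightarrow> m = j" using adjacent_F5(4)[OF n] F_F5 i by simp
      moreover have "bag i \<inter> bag j = {}" using AB[of "int m + s" "int j + s"] b by auto
      ultimately show ?thesis by blast
    next
      fix m n assume mn: "m \<in> {1..5}" "n \<in> {1..5}" and i: "i = 5 + m" and j: "j = 5 + n"
        and b: "bag i = A (int m + s)" "bag j = A (int n + s)"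
      have "m \<noteq> n" using ij(3) i j by simp
      note ne = v_neq[OF mn this]
      have "adjacent F i j \<longleftrightarrow> \<not> v (int m + s) \<sim> v (int n + s)"
        using v_adj'[OF mn] adjacent_F5(2)[OF mn] \<open>m \<noteq> n\<close> F_F5 i j by simp
      then show ?thesis
        using A_disjoint[OF ne] A_A_adj[OF _ _ ne] b by auto
    qed
    then show "bag i \<inter> bag j = {}"
      and "if adjacent F i j
        then \<forall>x \<in> bag i. \<forall>y \<in> bag j. x \<sim> y else \<forall>x \<in> bag i. \<forall>y \<in> bag j. \<not> x \<sim> y"
      by simp_all
  qed
  moreover have bag_ne: "bag n \<noteq> {}" if "n \<in> verts F" for n
  proof -
    have "B m \<noteq> {}" for m using v_in_B by blast
    then show ?thesis using split[OF that] pend that by auto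
  qed
  moreover have "\<exists>x. bag n = {x}" if n: "n \<in> verts F" and hammer: "induced_free G hammer_graph" for n
  proof -
    have "x = y" if "x \<in> bag n" "y \<in> bag n" for x y
      using split[OF n] B_singleton[OF hammer] A_at_most_one[OF hammer] that by auto
    then show ?thesis using bag_ne[OF n] by blast
  qed
  ultimately show ?thesis unfolding tight_blowup_def by blast
qed

text \<open>
  Read along the pentagram, the places with pendants form a subset of a 5-cycle without
  isolated points, that is, nothing, everything, or a single run of length 2, 3 or 4.
\<close>

lemma tight_blowup_of_family: "\<exists>F \<in> family_F'. tight_blowup F"
proof (cases "k = 5")
  case False
  then have "cycle_graph (nat k) \<in> family_F'"
    using k by (auto simp: family_F'_def)
  then show ?thesis using tight_blowup_if_long_hole[OF False] by blast
next
  case k5: True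
  have fam: "{cycle_graph 5, F2', F3, F4, F5} \<subseteq> family_F'"
    by (auto simp: family_F'_def)
  define p where "p i \<longleftrightarrow> A i \<noteq> {}" for i
  have per: "p i \<longleftrightarrow> p j" if "j = i + 5" for i j
    using A_cong[OF v_period[of i]] that k5 by (simp add: p_def)
  have near: "p (i + 2) \<or> p (i - 2)" if "p i" for i
    using no_isolated_pendants_no_remote(2)[of i] that by (simp add: p_def)
  have pend: "(\<And>n. n \<in> {1..5} \<Longrightarrow> 5 + n \<in> verts F \<longleftrightarrow> A (int n + s) \<noteq> {})"
    if "(6 \<in> verts F \<longleftrightarrow> p (1 + s)) \<and> (7 \<in> verts F \<longleftrightarrow> p (2 + s)) \<and> (8 \<in> verts F \<longleftrightarrow> p (3 + s)) \<and>
      (9 \<in> verts F \<longleftrightarrow> p (4 + s)) \<and> (10 \<in> verts F \<longleftrightarrow> p (5 + s))" for F :: "nat ugraph" and s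
  proof -
    fix n :: nat assume "n \<in> {1..5}"
    then have "n = 1 \<or> n = 2 \<or> n = 3 \<or> n = 4 \<or> n = 5" by auto
    then show "5 + n \<in> verts F \<longleftrightarrow> A (int n + s) \<noteq> {}"
      using that by (elim disjE) (simp_all add: p_def)
  qed
  have start: "\<exists>i. p i \<and> \<not> p (i - 2)" if "p j" "\<not> p l" for j l
  proof (rule ccontr)
    assume "\<not> ?thesis"
    then have down: "p i \<Longrightarrow> p (i - 2)" for i by blast
    \<comment> \<open>steps of length 2 reach every place modulo 5\<close>
    have "p (j - 2)" using down that(1) by blast
    moreover from this have "p (j - 4)" using down[of "j - 2"] by simp
    moreover from this have "p (j - 6)" using down[of "j - 4"] by simp
    moreover from this have "p (j - 8)" using down[of "j - 6"] by simp
    moreover have "p (j - 4) \<longleftrightarrow> p (j + 1)" "p (j - 6) \<longleftrightarrow> p (j - 1)" "p (j - 8) \<longleftrightarrow> p (j - 3)"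
      "p (j - 3) \<longleftrightarrow> p (j + 2)"
      by (rule per, simp)+
    ultimately have "p j" "p (j + 1)" "p (j + 2)" "p (j - 1)" "p (j - 2)"
      using that(1) by blast+
    moreover have "v l = v j \<or> v l = v (j + 1) \<or> v l = v (j + 2) \<or> v l = v (j - 1) \<or> v l = v (j - 2)"
      by (rule index_mod_5[OF k5])
    then have "p l = p j \<or> p l = p (j + 1) \<or> p l = p (j + 2) \<or> p l = p (j - 1) \<or> p l = p (j - 2)"
      unfolding p_def using A_cong by metis
    ultimately show False using that(2) by blast
  qed
  consider (none) "\<forall>i. \<not> p i" | (all) "\<forall>i. p i" | (run) i where "p i" "\<not> p (i - 2)"
    using start by blast
  then show ?thesis
  proof cases
    case none
    then have "tight_blowup (cycle_graph 5)"
      by (intro tight_blowup_if_5_hole[where s = 0] pend) (auto simp: k5 verts_C5)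
    then show ?thesis using fam by blast
  next
    case all
    then have "tight_blowup F5"
      by (intro tight_blowup_if_5_hole[where s = 0] pend) (auto simp: k5 verts_F)
    then show ?thesis using fam by blast
  next
    case run
    \<comment> \<open>The run starts at \<open>i\<close>. In the pentagram the pendants of \<open>F2'\<close>, \<open>F3\<close> and \<open>F4\<close> are the runs
      1-3, 4-1-3 and 4-1-3-5, so \<open>i\<close> has to be turned to 1 or to 4.\<close>
    have i2: "p (i + 2)" using near run by blast
    have eqs: "p (i - 2) \<longleftrightarrow> p (i + 3)" "p (i - 1) \<longleftrightarrow> p (i + 4)" "p (i - 3) \<longleftrightarrow> p (i + 2)"
      by (rule per, simp)+
    have i3: "\<not> p (i + 3)" using eqs(1) run by blast
    have p1: "p (i + 1) \<Longrightarrow> p (i + 4)"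
      using near[of "i + 1"] i3 eqs(2) by (simp add: algebra_simps)
    show ?thesis
    proof (cases "p (i + 4)")
      case False
      then have "tight_blowup F2'"
        using run i2 i3 p1
        by (intro tight_blowup_if_5_hole[where s = "i - 1"] pend) (auto simp: k5 verts_F algebra_simps)
      then show ?thesis using fam by blast
    next
      case i4: True
      have s: "p (1 + (i - 4))" "\<not> p (2 + (i - 4))" "p (3 + (i - 4))" "p (4 + (i - 4))"
        using i2 i4 run eqs by simp_all
      show ?thesis
      proof (cases "p (i + 1)")
        case True
        then have "tight_blowup F4"
          using s by (intro tight_blowup_if_5_hole[where s = "i - 4"] pend) (auto simp: k5 verts_F algebra_simps)
        then show ?thesis using fam by blast
      next
        case False
        then have "tight_blowup F3"
          using s by (intro tight_blowup_if_5_hole[where s = "i - 4"] pend) (auto simp: k5 verts_F algebra_simps)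
        then show ?thesis using fam by blast
      qed
    qed
  qed
qed

end

lemma family_loopless:
  assumes "F \<in> family_F'"
  shows "\<not> adjacent F i i"
  using assms
  by (auto simp: family_F'_def F2'_def F3_def F4_def F5_def adjacent_extend_graph
      adjacent_cycle_graph_iff)

theorem theorem1p3:
  fixes G :: "'a ugraph" and H :: "'b ugraph"
  assumes "simple_graph H" and "H \<cong>\<^sub>g bull_graph \<or> H \<cong>\<^sub>g hammer_graph"
    and "simple_graph G" and "connected_graph G"
    and "induced_free G (cycle_graph 4)"
    and "induced_free G fork_plus_graph"
    and "induced_free G H"
    and "\<not> (\<exists>K. clique_cutset G K)"
    and "\<not> (\<exists>K. universal_clique G K)"
  shows "(H \<cong>\<^sub>g hammer_graph \<longrightarrow> (\<exists>F \<in> family_F'. G \<cong>\<^sub>g F)) \<and>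
         (H \<cong>\<^sub>g bull_graph \<longrightarrow> (\<exists>F \<in> family_F'. nonempty_clique_blowup G F))"
proof -
  interpret cutset_free G
    using assms induced_free_iso by unfold_locales blast+
  obtain k v where "preferred_hole k v" using preferred_hole_exists by blast
  then interpret around_hole G k v by unfold_locales
  obtain F bag where F: "F \<in> family_F'" and bag: "clique_blowup_via G F bag"
    "\<forall>i \<in> verts F. bag i \<noteq> {}"
    "induced_free G hammer_graph \<longrightarrow> (\<forall>i \<in> verts F. \<exists>x. bag i = {x})"
    using tight_blowup_of_family unfolding tight_blowup_def by blast
  show ?thesis
  proof (intro conjI impI)
    assume "H \<cong>\<^sub>g hammer_graph"
    then have "induced_free G hammer_graph" using induced_free_iso assms(7) by blast
    then have "G \<cong>\<^sub>g F"
      using iso_if_singleton_blowup[OF bag(1)] bag(3) family_loopless[OF F] by simp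
    then show "\<exists>F \<in> family_F'. G \<cong>\<^sub>g F" using F by blast
  next
    show "\<exists>F \<in> family_F'. nonempty_clique_blowup G F"
      using F bag(1,2) unfolding nonempty_clique_blowup_def by blast
  qed
qed

end
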